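(* Let $(M,\omega)$ be an $n$-plectic manifold and let $\mathfrak g$ be a finite-dimensional real Lie algebra acting on $M$ and preserving $\omega$. The following statements are equivalent: (1) the action admits a homotopy moment map; (2) the action admits a weak moment map, and the map $\phi: P_{n+1,\mathfrak g}\to C^\infty(M)$, $p\mapsto \iota_{v_p}\omega$, vanishes identically.
   Context: $(M,\omega)$ is $n$-plectic ($n\ge 1$) if $\omega\in\Omega^{n+1}(M)$ is closed and $v\mapsto\iota_v\omega$ is injective as a map $TM\to\Lambda^nT^*M$. An action of $\mathfrak g$ is a Lie algebra homomorphism $\mathfrak g\to\mathfrak X(M)$, $x\mapsto v_x$ (for a left Lie group action, $v_x|_m=\frac{d}{dt}|_{t=0}\exp(-tx)\cdot m$); it preserves $\omega$ if $\mathcal L_{v_x}\omega=0$ for all $x\in\mathfrak g$. For $p=x_1\wedge\dots\wedge x_k\in\Lambda^k\mathfrak g$ put $v_p=v_{x_1}\wedge\dots\wedge v_{x_k}$ (extended linearly) and $\iota_{v_p}\omega=\iota_{v_{x_k}}\cdots\iota_{v_{x_1}}\omega$. The Lie algebra homology differential $\delta_k:\Lambda^k\mathfrak g\to\Lambda^{k-1}\mathfrak g$ ($k\ge1$) is $$\delta_k(x_1\wedge\dots\wedge x_k)=\sum_{1\le i<j\le k}(-1)^{i+j}[x_i,x_j]\wedge x_1\wedge\dots\widehat{x_i}\dots\widehat{x_j}\dots\wedge x_k,$$ and $P_{k,\mathfrak g}=\ker\delta_k$. Put $\zeta(k)=-(-1)^{k(k+1)/2}$. A homotopy moment map for the action is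 a collection of linear maps $\widetilde f_k:\Lambda^k\mathfrak g\to\Omega^{n-k}(M)$, $1\le k\le n$, such that $-\widetilde f_{k-1}(\delta_k p)=d\widetilde f_k(p)+\zeta(k)\iota_{v_p}\omega$ for all $p\in\Lambda^k\mathfrak g$ and all $1\le k\le n+1$, where $\widetilde f_0=\widetilde f_{n+1}=0$. A weak moment map for the action is a collection of linear maps $\widehat f_k:P_{k,\mathfrak g}\to\Omega^{n-k}(M)$, $1\le k\le n$, such that $d\widehat f_k(p)=-\zeta(k)\iota_{v_p}\omega$ for all $p\in P_{k,\mathfrak g}$ and all $1\le k\le n$. (In both cases the $k=1$ equation says that each $v_x$ is a Hamiltonian vector field.) *)

theory Defs
  imports "HOL-Analysis.Analysis" "HOL-Library.Function_Algebras"
begin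

section \<open>Pointwise vector space structure on functions\<close>

text \<open>Multivectors, tangent vectors, vector fields and differential forms are all represented by
  functions, and sums and multiples of them are taken pointwise.\<close>

instantiation "fun" :: (type, real_vector) real_vector
begin

definition scaleR_fun_def: "scaleR r f = (\<lambda>x. scaleR r (f x))"

instance
  by standard (auto simp: scaleR_fun_def fun_eq_iff scaleR_add_left scaleR_add_right)

end

lemma scaleR_fun_apply [simp]: "(r *\<^sub>R f) x = r *\<^sub>R f x"
  by (simp add: scaleR_fun_def)

lemma sum_fun_apply: "(\<Sum>i\<in>I. f i) x = (\<Sum>i\<in>I. f i x)"
  by (induction I rule: infinite_finite_induct) auto

definition linear_on :: "'b::real_vector set \<Rightarrow> ('b \<Rightarrow> 'c::real_vector) \<Rightarrow> bool" where
  "linear_on S f \<longleftrightarrow>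
     (\<forall>p\<in>S. \<forall>q\<in>S. \<forall>a b. f (a *\<^sub>R p + b *\<^sub>R q) = a *\<^sub>R f p + b *\<^sub>R f q)"

section \<open>Alternating forms and exterior powers\<close>

text \<open>A \<open>k\<close>-multilinear alternating form on a subspace \<open>S\<close> is a function of lists which is normalised
  to be \<open>0\<close> on all lists that are not \<open>k\<close>-tuples of elements of \<open>S\<close>.\<close>

definition alternating_on :: "'b::real_vector set \<Rightarrow> nat \<Rightarrow> ('b list \<Rightarrow> real) \<Rightarrow> bool" where
  "alternating_on S k \<alpha> \<longleftrightarrow>
     (\<forall>xs. \<not> (length xs = k \<and> set xs \<subseteq> S) \<longrightarrow> \<alpha> xs = 0) \<and>
     (\<forall>xs i x y a b. length xs = k \<and> set xs \<subseteq> S \<and> i < k \<and> x \<in> S \<and> y \<in> S \<longrightarrow>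
        \<alpha> (xs[i := a *\<^sub>R x + b *\<^sub>R y]) = a * \<alpha> (xs[i := x]) + b * \<alpha> (xs[i := y])) \<and>
     (\<forall>xs. length xs = k \<and> set xs \<subseteq> S \<and> \<not> distinct xs \<longrightarrow> \<alpha> xs = 0)"

text \<open>The exterior power is realised inside the dual of the space of alternating forms:
  \<open>x\<^sub>1 \<and> \<dots> \<and> x\<^sub>k\<close> is the functional evaluating an alternating \<open>k\<close>-form at \<open>(x\<^sub>1, \<dots>, x\<^sub>k)\<close>.
  The canonical map from \<open>\<Lambda>\<^sup>k\<close> into that dual is injective, so the span of these functionals
  is \<open>\<Lambda>\<^sup>k\<close>.  Functionals are normalised to be \<open>0\<close> on functions that are not alternating
  \<open>k\<close>-forms.\<close>

type_synonym 'g multivector = "('g list \<Rightarrow> real) \<Rightarrow> real"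

definition wedge :: "'g::real_vector list \<Rightarrow> 'g multivector" where
  "wedge xs = (\<lambda>\<alpha>. if alternating_on UNIV (length xs) \<alpha> then \<alpha> xs else 0)"

definition ext_power :: "nat \<Rightarrow> 'g::real_vector multivector set" where
  "ext_power k = span {wedge xs | xs. length xs = k}"

section \<open>Lie algebras and the homology differential\<close>

definition fin_dim_lie_algebra :: "('g::real_vector \<Rightarrow> 'g \<Rightarrow> 'g) \<Rightarrow> bool" where
  "fin_dim_lie_algebra br \<longleftrightarrow>
     (\<exists>B::'g set. finite B \<and> span B = UNIV) \<and>
     bilinear br \<and> (\<forall>x. br x x = 0) \<and>
     (\<forall>x y z. br x (br y z) + br y (br z x) + br z (br x y) = 0)"

text \<open>Indices are counted from \<open>0\<close>, which does not change the sign \<open>(-1)\<^bsup>i+j\<^esup>\<close>;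
  \<open>nths xs (- {i, j})\<close> is \<open>xs\<close> with the entries at positions \<open>i\<close> and \<open>j\<close> omitted.\<close>

definition delta_decomposable ::
  "('g::real_vector \<Rightarrow> 'g \<Rightarrow> 'g) \<Rightarrow> 'g list \<Rightarrow> 'g multivector" where
  "delta_decomposable br xs =
     (\<Sum>j<length xs. \<Sum>i<j. (-1) ^ (i + j) *\<^sub>R wedge (br (xs ! i) (xs ! j) # nths xs (- {i, j})))"

text \<open>The linear extension of a map \<open>F\<close> given on decomposables sends \<open>p\<close> to
  \<open>\<lambda>\<alpha>. p (\<lambda>xs. F xs \<alpha>)\<close>, because \<open>wedge xs\<close> acts by evaluation at \<open>xs\<close>;
  see \<open>lie_delta_wedge\<close> below, and likewise \<open>contract_wedge\<close> for contractions.\<close>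

definition lie_delta ::
  "('g::real_vector \<Rightarrow> 'g \<Rightarrow> 'g) \<Rightarrow> 'g multivector \<Rightarrow> 'g multivector" where
  "lie_delta br p = (\<lambda>\<alpha>. p (\<lambda>xs. delta_decomposable br xs \<alpha>))"

lemma alternating_on_support:
  "alternating_on S k \<alpha> \<Longrightarrow> length xs \<noteq> k \<or> \<not> set xs \<subseteq> S \<Longrightarrow> \<alpha> xs = 0"
  unfolding alternating_on_def by blast

lemma alternating_on_linear:
  "alternating_on S k \<alpha> \<Longrightarrow> length xs = k \<Longrightarrow> set xs \<subseteq> S \<Longrightarrow> i < k \<Longrightarrow> x \<in> S \<Longrightarrow> y \<in> S \<Longrightarrow>
     \<alpha> (xs[i := a *\<^sub>R x + b *\<^sub>R y]) = a * \<alpha> (xs[i := x]) + b * \<alpha> (xs[i := y])"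
  unfolding alternating_on_def by blast

lemma alternating_on_repeated:
  "alternating_on S k \<alpha> \<Longrightarrow> \<not> distinct xs \<Longrightarrow> \<alpha> xs = 0"
  unfolding alternating_on_def by blast

lemma alternating_onI_adjacent:
  fixes \<beta> :: "'b::real_vector list \<Rightarrow> real"
  assumes supp: "\<And>xs. length xs \<noteq> k \<Longrightarrow> \<beta> xs = 0"
    and lin: "\<And>xs i x y a b. length xs = k \<Longrightarrow> i < k \<Longrightarrow>
      \<beta> (xs[i := a *\<^sub>R x + b *\<^sub>R y]) = a * \<beta> (xs[i := x]) + b * \<beta> (xs[i := y])"
    and adj: "\<And>xs i. length xs = k \<Longrightarrow> Suc i < k \<Longrightarrow> xs ! i = xs ! Suc i \<Longrightarrow> \<beta> xs = 0"
  shows "alternating_on UNIV k \<beta>"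
proof -
  have add: "\<beta> (xs[i := x + y]) = \<beta> (xs[i := x]) + \<beta> (xs[i := y])"
    if "length xs = k" "i < k" for xs i x y
    using lin[OF that, of 1 x 1 y] by simp
  have swap: "\<beta> (xs[i := xs ! Suc i, Suc i := xs ! i]) = - \<beta> xs"
    if "length xs = k" "Suc i < k" for xs i
  proof -
    let ?x = "xs ! i" and ?y = "xs ! Suc i"
    have "0 = \<beta> (xs[i := ?x + ?y, Suc i := ?x + ?y])"
      by (rule adj[symmetric, of _ i]) (use that in auto)
    also have "\<dots> = \<beta> (xs[i := ?x + ?y, Suc i := ?x]) + \<beta> (xs[i := ?x + ?y, Suc i := ?y])"
      by (rule add) (use that in auto)
    also have "xs[i := ?x + ?y, Suc i := ?x] = xs[Suc i := ?x, i := ?x + ?y]"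
      by (simp add: list_update_swap)
    also have "xs[i := ?x + ?y, Suc i := ?y] = xs[Suc i := ?y, i := ?x + ?y]"
      by (simp add: list_update_swap)
    also have "\<beta> (xs[Suc i := ?x, i := ?x + ?y]) =
        \<beta> (xs[Suc i := ?x, i := ?x]) + \<beta> (xs[Suc i := ?x, i := ?y])"
      by (rule add) (use that in auto)
    also have "\<beta> (xs[Suc i := ?y, i := ?x + ?y]) =
        \<beta> (xs[Suc i := ?y, i := ?x]) + \<beta> (xs[Suc i := ?y, i := ?y])"
      by (rule add) (use that in auto)
    also have "\<beta> (xs[Suc i := ?x, i := ?x]) = 0"
      by (rule adj[of _ i]) (use that in auto)
    also have "\<beta> (xs[Suc i := ?y, i := ?y]) = 0"
      by (rule adj[of _ i]) (use that in auto)
    also have "xs[Suc i := ?y, i := ?x] = xs" by simp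
    finally show ?thesis by (simp add: list_update_swap)
  qed
  have rep: "\<beta> xs = 0" if "length xs = k" "i + Suc d < k" "xs ! i = xs ! (i + Suc d)" for xs i d
    using that
  proof (induction d arbitrary: xs)
    case 0
    then show ?case using adj by simp
  next
    case (Suc d)
    let ?j = "i + Suc d"
    let ?ys = "xs[?j := xs ! Suc ?j, Suc ?j := xs ! ?j]"
    have "\<beta> ?ys = 0" by (rule Suc.IH) (use Suc.prems in auto)
    moreover have "\<beta> ?ys = - \<beta> xs" by (rule swap) (use Suc.prems in auto)
    ultimately show ?case by simp
  qed
  have rep': "\<beta> xs = 0" if l: "length xs = k" and nd: "\<not> distinct xs" for xs
  proof -
    obtain i j where ij: "i < j" "j < k" "xs ! i = xs ! j"
      using l nd unfolding distinct_conv_nth by (metis linorder_neqE_nat)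
    then obtain d where "j = i + Suc d" using less_iff_Suc_add[of i j] by auto
    then show ?thesis using rep[of xs i d] l ij by simp
  qed
  show ?thesis
    unfolding alternating_on_def using supp lin rep' by (intro conjI allI impI) blast+
qed

lemma nths_list_update:
  assumes "l < length xs" "l \<in> I"
  shows "\<exists>r<length (nths xs I). \<forall>z. nths (xs[l := z]) I = (nths xs I)[r := z]"
proof -
  obtain ys w zs where xs: "xs = ys @ w # zs" and l: "length ys = l"
    using assms id_take_nth_drop[of l xs] by (metis length_take min.absorb4)
  have "nths (ys @ u # zs) I = nths ys I @ u # nths zs {j. Suc j + l \<in> I}" for u
    using assms(2) l by (simp add: nths_append nths_Cons)
  then show ?thesis
    unfolding xs by (intro exI[of _ "length (nths ys I)"]) (simp add: l list_update_append)
qed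

lemma nths_list_update_notin:
  "l \<notin> I \<Longrightarrow> nths (xs[l := z]) I = nths xs I"
proof (cases "l < length xs")
  case True
  assume "l \<notin> I"
  obtain ys w zs where xs: "xs = ys @ w # zs" and l: "length ys = l"
    using True id_take_nth_drop[of l xs] by (metis length_take min.absorb4)
  show ?thesis unfolding xs using \<open>l \<notin> I\<close> l 
    by (simp add: nths_append nths_Cons list_update_append)
qed (simp add: list_update_beyond)

lemma split_equal_entries:
  assumes "Suc a < length xs" "xs ! a = xs ! Suc a"
  obtains ys w zs where "xs = ys @ w # w # zs" "length ys = a"
proof
  show "xs = take a xs @ xs ! a # xs ! a # drop (Suc (Suc a)) xs"
    using id_take_nth_drop[of a xs] Cons_nth_drop_Suc[of "Suc a" xs] assms by simp
qed (use assms in simp)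

lemma nths_equal_entries:
  assumes "Suc a < length xs" "xs ! a = xs ! Suc a" "a \<in> I" "Suc a \<notin> I"
  shows "nths xs I = nths xs (insert (Suc a) I - {a})"
proof -
  obtain ys w zs where xs: "xs = ys @ w # w # zs" and l: "length ys = a"
    using assms(1,2) by (rule split_equal_entries)
  have e: "nths ys I = nths ys (insert (Suc a) I - {a})"
    unfolding nths_def using l
    by (intro arg_cong[where f = "map fst"] filter_cong) (auto simp: set_zip)
  show ?thesis
    unfolding xs using assms(3,4) by (simp add: nths_append nths_Cons e l)
qed

lemma length_nths_two:
  assumes "i < j" "j < length xs"
  shows "length (nths xs (- {i, j})) = length xs - 2"
proof -
  have "{l. l < length xs \<and> l \<in> - {i, j}} = {..<length xs} - {i, j}" by auto
  then show ?thesis using assms by (simp add: length_nths card_Diff_subset)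
qed

lemma alternating_delta:
  fixes br :: "'g::real_vector \<Rightarrow> 'g \<Rightarrow> 'g"
  assumes br: "bilinear br" "\<And>x. br x x = 0"
    and \<alpha>: "alternating_on UNIV k \<alpha>"
  shows "alternating_on UNIV (Suc k) (\<lambda>xs. delta_decomposable br xs \<alpha>)"
proof -
  define T where "T xs i j = \<alpha> (br (xs ! i) (xs ! j) # nths xs (- {i, j}))" for xs i j
  have len: "length (br (xs ! i) (xs ! j) # nths xs (- {i, j})) = length xs - 1"
    if "i < j" "j < length xs" for xs i j
    using that length_nths_two[OF that] by simp
  have wT: "wedge (br (xs ! i) (xs ! j) # nths xs (- {i, j})) \<alpha> = T xs i j"
    if "i < j" "j < length xs" for xs i j
  proof (cases "length (br (xs ! i) (xs ! j) # nths xs (- {i, j})) = k")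
    case True
    then show ?thesis unfolding wedge_def T_def using \<alpha> by (simp only: if_True)
  next
    case False
    then have "T xs i j = 0" unfolding T_def by (intro alternating_on_support[OF \<alpha>]) blast
    then show ?thesis unfolding wedge_def T_def by (simp only: if_cancel)
  qed
  have D: "delta_decomposable br xs \<alpha> = (\<Sum>j<length xs. \<Sum>i<j. (-1) ^ (i + j) * T xs i j)" for xs
    unfolding delta_decomposable_def sum_fun_apply scaleR_fun_apply
    by (intro sum.cong refl) (simp add: wT)
  show ?thesis
  proof (rule alternating_onI_adjacent)
    fix xs :: "'g list"
    assume l: "length xs \<noteq> Suc k"
    have "T xs i j = 0" if "i < j" "j < length xs" for i j
      unfolding T_def using len[OF that] l that by (intro alternating_on_support[OF \<alpha>]) auto
    then show "delta_decomposable br xs \<alpha> = 0" unfolding D by simp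
  next
    fix xs :: "'g list" and l and x y :: 'g and a b :: real
    assume xs: "length xs = Suc k" and l: "l < Suc k"
    let ?z = "a *\<^sub>R x + b *\<^sub>R y"
    have "T (xs[l := ?z]) i j = a * T (xs[l := x]) i j + b * T (xs[l := y]) i j"
      if ij: "i < j" "j < Suc k" for i j
    proof -
      let ?t = "nths xs (- {i, j})"
      have lt: "Suc (length ?t) = k" using ij length_nths_two[of i j xs] xs by simp
      have \<alpha>0: "\<alpha> ((a *\<^sub>R u + b *\<^sub>R w) # ?t) = a * \<alpha> (u # ?t) + b * \<alpha> (w # ?t)" for u w
        using alternating_on_linear[OF \<alpha>, of "0 # ?t" 0 u w a b] lt by simp
      consider "l = i" | "l = j" | "l \<noteq> i" "l \<noteq> j" by blast
      then show ?thesis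
      proof cases
        case 1
        then have "nths (xs[l := z]) (- {i, j}) = ?t" for z :: 'g by (simp add: nths_list_update_notin)
        then show ?thesis using 1 ij xs
          by (simp add: T_def bilinear_ladd[OF br(1)] bilinear_lmul[OF br(1)] \<alpha>0)
      next
        case 2
        then have "nths (xs[l := z]) (- {i, j}) = ?t" for z :: 'g by (simp add: nths_list_update_notin)
        then show ?thesis using 2 ij xs
          by (simp add: T_def bilinear_radd[OF br(1)] bilinear_rmul[OF br(1)] \<alpha>0)
      next
        case 3
        then obtain r where r: "r < length ?t" "\<And>z. nths (xs[l := z]) (- {i, j}) = ?t[r := z]"
          using nths_list_update[of l xs "- {i, j}"] l xs by auto
        show ?thesis
          using alternating_on_linear[OF \<alpha>, of "br (xs ! i) (xs ! j) # ?t" "Suc r" x y a b] lt r 3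
          by (simp add: T_def)
      qed
    qed
    then show "delta_decomposable br (xs[l := ?z]) \<alpha> =
        a * delta_decomposable br (xs[l := x]) \<alpha> + b * delta_decomposable br (xs[l := y]) \<alpha>"
      unfolding D length_list_update xs sum_distrib_left sum.distrib[symmetric]
      by (intro sum.cong refl) (simp add: algebra_simps)
  next
    fix xs :: "'g list" and a
    assume xs: "length xs = Suc k" and a: "Suc a < Suc k" "xs ! a = xs ! Suc a"
    define P where "P = {(i, j). i < j \<and> j < Suc k} - {(a, Suc a)}"
    define s where "s i = (if i = a then Suc a else if i = Suc a then a else i)" for i
    define g where "g = (\<lambda>(i, j). (-1) ^ (i + j) * T xs i j)"
    have fin: "finite {(i, j). i < j \<and> j < Suc k}"
      by (rule finite_subset[of _ "{..k} \<times> {..k}"]) auto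
    have "delta_decomposable br xs \<alpha> = sum g {(i, j). i < j \<and> j < Suc k}"
      unfolding D xs g_def
      by (subst sum.Sigma, simp, simp, rule sum.reindex_bij_witness[of _ prod.swap prod.swap]) auto
    also have "\<dots> = g (a, Suc a) + sum g P"
      unfolding P_def using fin a by (subst sum.remove[of _ "(a, Suc a)"]) auto
    also have "g (a, Suc a) = 0"
    proof -
      have "br (xs ! a) (xs ! Suc a) = 0" using a br(2) by simp
      then have "T xs a (Suc a) = \<alpha> ((0 # nths xs (- {a, Suc a}))[0 := 0 *\<^sub>R 0 + 0 *\<^sub>R 0])"
        by (simp add: T_def)
      also have "\<dots> = 0"
        using length_nths_two[of a "Suc a" xs] a xs by (subst alternating_on_linear[OF \<alpha>]) auto
      finally show ?thesis by (simp add: g_def)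
    qed
    also have "sum g P = 0"
    proof -
      have "g (s i, s j) = - g (i, j)" if ij: "(i, j) \<in> P" for i j
      proof -
        have "i < j" "j < Suc k" "(i, j) \<noteq> (a, Suc a)" using ij by (auto simp: P_def)
        have n1: "nths xs (- {c, Suc a}) = nths xs (- {c, a})" if "c \<noteq> a" "c \<noteq> Suc a" for c
        proof -
          have "insert (Suc a) (- {c, Suc a}) - {a} = - {c, a}" using that by auto
          then show ?thesis
            using nths_equal_entries[of a xs "- {c, Suc a}"] a xs that by simp
        qed
        consider "i = a" "j \<noteq> Suc a" "j \<noteq> a" | "i = Suc a" "j \<noteq> Suc a" "j \<noteq> a"
          | "j = a" "i \<noteq> a" "i \<noteq> Suc a" | "j = Suc a" "i \<noteq> a" "i \<noteq> Suc a"
          | "i \<noteq> a" "j \<noteq> a" "i \<noteq> Suc a" "j \<noteq> Suc a"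
          using \<open>i < j\<close> \<open>(i, j) \<noteq> (a, Suc a)\<close> by force
        then show ?thesis
        proof cases
          case 1
          then show ?thesis using a n1[of j] by (simp add: g_def s_def T_def insert_commute)
        next
          case 2
          then show ?thesis using a n1[of j] by (simp add: g_def s_def T_def insert_commute)
        next
          case 3
          then show ?thesis using a n1[of i] by (simp add: g_def s_def T_def)
        next
          case 4
          then show ?thesis using a n1[of i] by (simp add: g_def s_def T_def)
        next
          case 5
          have "\<not> distinct (nths xs (- {i, j}))"
          proof
            assume d: "distinct (nths xs (- {i, j}))"
            obtain ys zs w where *: "xs = ys @ w # w # zs" "length ys = a"
              using split_equal_entries[of a xs] a xs by metis
            show False using d 5 unfolding *(1) by (simp add: nths_append nths_Cons *(2))
          qed
          then have "T xs i j = 0" unfolding T_def by (intro alternating_on_repeated[OF \<alpha>]) auto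
          then show ?thesis using 5 by (simp add: g_def s_def)
        qed
      qed
      then have "sum g P = (\<Sum>p\<in>P. - g (s (fst p), s (snd p)))"
        by (intro sum.cong) auto
      also have "\<dots> = - (\<Sum>p\<in>P. g (s (fst p), s (snd p)))" by (simp add: sum_negf)
      also have "(\<Sum>p\<in>P. g (s (fst p), s (snd p))) = sum g P"
        by (rule sum.reindex_bij_witness[of _ "\<lambda>p. (s (fst p), s (snd p))"
              "\<lambda>p. (s (fst p), s (snd p))"]) (use a in \<open>auto simp: P_def s_def split: if_splits\<close>)
      finally show ?thesis by simp
    qed
    finally show "delta_decomposable br xs \<alpha> = 0" by simp
  qed
qed

lemma lie_delta_wedge:
  assumes "bilinear br" "\<And>x. br x x = 0"
  shows "lie_delta br (wedge xs) = delta_decomposable br xs"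
proof
  fix \<alpha>
  show "lie_delta br (wedge xs) \<alpha> = delta_decomposable br xs \<alpha>"
  proof (cases "xs \<noteq> [] \<and> alternating_on UNIV (length xs - 1) \<alpha>")
    case True
    then have "alternating_on UNIV (length xs) (\<lambda>ys. delta_decomposable br ys \<alpha>)"
      using alternating_delta[OF assms, of "length xs - 1" \<alpha>] by simp
    then show ?thesis
      unfolding lie_delta_def wedge_def by (simp only: if_True)
  next
    case False
    have "wedge (br (xs ! i) (xs ! j) # nths xs (- {i, j})) \<alpha> = 0"
      if "i < j" "j < length xs" for i j
    proof -
      have "length (br (xs ! i) (xs ! j) # nths xs (- {i, j})) = length xs - 1" "xs \<noteq> []"
        using that length_nths_two[OF that] by auto
      then show ?thesis unfolding wedge_def using False by presburger
    qed
    then have "delta_decomposable br xs \<alpha> = 0"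
      unfolding delta_decomposable_def sum_fun_apply by simp
    then show ?thesis by (simp add: lie_delta_def wedge_def)
  qed
qed

definition lie_kernel :: "('g::real_vector \<Rightarrow> 'g \<Rightarrow> 'g) \<Rightarrow> nat \<Rightarrow> 'g multivector set" where
  "lie_kernel br k = {p \<in> ext_power k. lie_delta br p = 0}"

section \<open>Smooth manifolds\<close>

primrec Ck_on ::
  "nat \<Rightarrow> 'e::real_normed_vector set \<Rightarrow> ('e \<Rightarrow> 'f::real_normed_vector) \<Rightarrow> bool" where
  "Ck_on 0 S f \<longleftrightarrow> continuous_on S f"
| "Ck_on (Suc k) S f \<longleftrightarrow>
     (\<forall>x\<in>S. f differentiable (at x)) \<and>
     (\<forall>e. Ck_on k S (\<lambda>x. frechet_derivative f (at x) e))"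

definition smooth_on ::
  "'e::real_normed_vector set \<Rightarrow> ('e \<Rightarrow> 'f::real_normed_vector) \<Rightarrow> bool" where
  "smooth_on S f \<longleftrightarrow> (\<forall>k. Ck_on k S f)"

text \<open>A chart is a pair of its domain and its coordinate map.  The model space \<open>'e\<close> is any
  finite-dimensional inner product space; unlike in the class \<open>euclidean_space\<close>,
  dimension \<open>0\<close> is not excluded.\<close>

type_synonym ('a, 'e) chart = "'a set \<times> ('a \<Rightarrow> 'e)"

abbreviation chart_dom :: "('a, 'e) chart \<Rightarrow> 'a set" where "chart_dom c \<equiv> fst c"
abbreviation coord :: "('a, 'e) chart \<Rightarrow> 'a \<Rightarrow> 'e" where "coord c \<equiv> snd c"
abbreviation param :: "('a, 'e) chart \<Rightarrow> 'e \<Rightarrow> 'a" where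
  "param c \<equiv> inv_into (chart_dom c) (coord c)"

definition points :: "('a, 'e) chart set \<Rightarrow> 'a set" where
  "points A = (\<Union>c\<in>A. chart_dom c)"

definition charts_at :: "('a, 'e) chart set \<Rightarrow> 'a \<Rightarrow> ('a, 'e) chart set" where
  "charts_at A m = {c \<in> A. m \<in> chart_dom c}"

definition smooth_manifold :: "'a topology \<Rightarrow> ('a, 'e::real_inner) chart set \<Rightarrow> bool" where
  "smooth_manifold X A \<longleftrightarrow>
     (\<exists>B::'e set. finite B \<and> span B = UNIV) \<and>
     Hausdorff_space X \<and> second_countable X \<and> points A = topspace X \<and>
     (\<forall>c\<in>A. openin X (chart_dom c) \<and> open (coord c ` chart_dom c) \<and>
        homeomorphic_map (subtopology X (chart_dom c)) (top_of_set (coord c ` chart_dom c)) (coord c)) \<and>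
     (\<forall>c\<in>A. \<forall>c'\<in>A. smooth_on (coord c ` (chart_dom c \<inter> chart_dom c')) (coord c' \<circ> param c))"

section \<open>Tangent vectors, vector fields and forms\<close>

text \<open>A tangent vector at \<open>m\<close> is given by its components in all charts around \<open>m\<close>, related by
  the derivatives of the transition maps; it is normalised to be \<open>0\<close> on everything else.\<close>

type_synonym ('a, 'e) tangent = "('a, 'e) chart \<Rightarrow> 'e"
type_synonym ('a, 'e) vfield = "'a \<Rightarrow> ('a, 'e) tangent"
type_synonym ('a, 'e) form = "'a \<Rightarrow> ('a, 'e) tangent list \<Rightarrow> real"

definition transition_deriv ::
  "('a, 'e::real_inner) chart \<Rightarrow> ('a, 'e) chart \<Rightarrow> 'a \<Rightarrow> 'e \<Rightarrow> 'e" where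
  "transition_deriv c c' m = frechet_derivative (coord c' \<circ> param c) (at (coord c m))"

definition tangent_space :: "('a, 'e::real_inner) chart set \<Rightarrow> 'a \<Rightarrow> ('a, 'e) tangent set" where
  "tangent_space A m =
     {u. (\<forall>c\<in>charts_at A m. \<forall>c'\<in>charts_at A m. u c' = transition_deriv c c' m (u c)) \<and>
         (\<forall>c. c \<notin> charts_at A m \<longrightarrow> u c = 0)}"

text \<open>The tangent vector at \<open>m\<close> with components \<open>e\<close> in the chart \<open>c\<close>.\<close>

definition chart_vector ::
  "('a, 'e::real_inner) chart set \<Rightarrow> ('a, 'e) chart \<Rightarrow> 'a \<Rightarrow> 'e \<Rightarrow> ('a, 'e) tangent" where
  "chart_vector A c m e = (\<lambda>c'. if c' \<in> charts_at A m then transition_deriv c c' m e else 0)"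

definition vector_fields :: "('a, 'e::real_inner) chart set \<Rightarrow> ('a, 'e) vfield set" where
  "vector_fields A =
     {V. (\<forall>m\<in>points A. V m \<in> tangent_space A m) \<and> (\<forall>m. m \<notin> points A \<longrightarrow> V m = 0) \<and>
         (\<forall>c\<in>A. smooth_on (coord c ` chart_dom c) (\<lambda>x. V (param c x) c))}"

text \<open>\<open>[V, W]\<^sup>i = V\<^sup>j \<partial>\<^sub>j W\<^sup>i - W\<^sup>j \<partial>\<^sub>j V\<^sup>i\<close> in every chart.\<close>

definition lie_bracket ::
  "('a, 'e::real_inner) chart set \<Rightarrow> ('a, 'e) vfield \<Rightarrow> ('a, 'e) vfield \<Rightarrow> ('a, 'e) vfield" where
  "lie_bracket A V W = (\<lambda>m c. if c \<in> charts_at A m then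
       frechet_derivative (\<lambda>x. W (param c x) c) (at (coord c m)) (V m c) -
       frechet_derivative (\<lambda>x. V (param c x) c) (at (coord c m)) (W m c)
     else 0)"

text \<open>The coordinate representation of a form in the chart \<open>c\<close>, at \<open>x \<in> coord c ` chart_dom c\<close>.\<close>

definition local_form ::
  "('a, 'e::real_inner) chart set \<Rightarrow> ('a, 'e) chart \<Rightarrow> ('a, 'e) form \<Rightarrow> 'e \<Rightarrow> 'e list \<Rightarrow> real" where
  "local_form A c \<alpha> x es = \<alpha> (param c x) (map (chart_vector A c (param c x)) es)"

definition forms :: "('a, 'e::real_inner) chart set \<Rightarrow> nat \<Rightarrow> ('a, 'e) form set" where
  "forms A k =
     {\<alpha>. (\<forall>m\<in>points A. alternating_on (tangent_space A m) k (\<alpha> m)) \<and>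
         (\<forall>m. m \<notin> points A \<longrightarrow> \<alpha> m = 0) \<and>
         (\<forall>c\<in>A. \<forall>es. length es = k \<longrightarrow>
            smooth_on (coord c ` chart_dom c) (\<lambda>x. local_form A c \<alpha> x es))}"

text \<open>The exterior and Lie derivatives are evaluated at a point by their usual coordinate formulas
  in some chart around that point; the results do not depend on the chart.\<close>

definition chart_at :: "('a, 'e) chart set \<Rightarrow> 'a \<Rightarrow> ('a, 'e) chart" where
  "chart_at A m = (SOME c. c \<in> charts_at A m)"

definition ext_deriv ::
  "('a, 'e::real_inner) chart set \<Rightarrow> ('a, 'e) form \<Rightarrow> ('a, 'e) form" where
  "ext_deriv A \<alpha> = (\<lambda>m us. if m \<in> points A \<and> set us \<subseteq> tangent_space A m then
       (let c = chart_at A m; es = map (\<lambda>u. u c) us in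
         \<Sum>i<length es. (-1) ^ i *
           frechet_derivative (\<lambda>x. local_form A c \<alpha> x (nths es (- {i}))) (at (coord c m)) (es ! i))
     else 0)"

definition lie_deriv ::
  "('a, 'e::real_inner) chart set \<Rightarrow> ('a, 'e) vfield \<Rightarrow> ('a, 'e) form \<Rightarrow> ('a, 'e) form" where
  "lie_deriv A V \<alpha> = (\<lambda>m us. if m \<in> points A \<and> set us \<subseteq> tangent_space A m then
       (let c = chart_at A m; es = map (\<lambda>u. u c) us in
         frechet_derivative (\<lambda>x. local_form A c \<alpha> x es) (at (coord c m)) (V m c) +
         (\<Sum>i<length es. local_form A c \<alpha> (coord c m)
           (es[i := frechet_derivative (\<lambda>x. V (param c x) c) (at (coord c m)) (es ! i)])))
     else 0)"

definition interior_product :: "('a, 'e) vfield \<Rightarrow> ('a, 'e) form \<Rightarrow> ('a, 'e) form" where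
  "interior_product V \<alpha> = (\<lambda>m us. \<alpha> m (V m # us))"

section \<open>Actions and moment maps\<close>

definition n_plectic ::
  "'a topology \<Rightarrow> ('a, 'e::real_inner) chart set \<Rightarrow> nat \<Rightarrow> ('a, 'e) form \<Rightarrow> bool" where
  "n_plectic X A n \<omega> \<longleftrightarrow>
     n \<ge> 1 \<and> smooth_manifold X A \<and> \<omega> \<in> forms A (n + 1) \<and> ext_deriv A \<omega> = 0 \<and>
     (\<forall>m\<in>points A. inj_on (\<lambda>u us. \<omega> m (u # us)) (tangent_space A m))"

definition lie_algebra_action ::
  "('a, 'e::real_inner) chart set \<Rightarrow> ('g::real_vector \<Rightarrow> 'g \<Rightarrow> 'g) \<Rightarrow> ('g \<Rightarrow> ('a, 'e) vfield) \<Rightarrow> bool"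
  where
  "lie_algebra_action A br v \<longleftrightarrow>
     (\<forall>x. v x \<in> vector_fields A) \<and> linear v \<and>
     (\<forall>x y. v (br x y) = lie_bracket A (v x) (v y))"

text \<open>\<open>\<iota>\<^bsub>v\<^sub>p\<^esub>\<omega>\<close>: the linear extension in \<open>p\<close> of
  \<open>x\<^sub>1 \<and> \<dots> \<and> x\<^sub>k \<mapsto> \<iota>\<^bsub>v x\<^sub>k\<^esub> \<cdots> \<iota>\<^bsub>v x\<^sub>1\<^esub> \<omega>\<close>.\<close>

definition contract ::
  "('g \<Rightarrow> ('a, 'e) vfield) \<Rightarrow> ('a, 'e) form \<Rightarrow> 'g multivector \<Rightarrow> ('a, 'e) form" where
  "contract v \<omega> p = (\<lambda>m us. p (\<lambda>xs. fold (\<lambda>x. interior_product (v x)) xs \<omega> m us))"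

lemma fold_interior_product:
  "fold (\<lambda>x. interior_product (v x)) xs \<omega> m us = \<omega> m (map (\<lambda>x. v x m) xs @ us)"
  by (induction xs arbitrary: \<omega> us) (auto simp: interior_product_def)

lemma contract_wedge:
  fixes v :: "'g::real_vector \<Rightarrow> ('a, 'e::real_inner) vfield"
  assumes \<omega>: "\<omega> \<in> forms A N" and v: "linear v" "\<And>x. v x \<in> vector_fields A"
  shows "contract v \<omega> (wedge xs) = fold (\<lambda>x. interior_product (v x)) xs \<omega>"
proof (intro ext)
  fix m us
  let ?f = "\<lambda>x. v x m"
  have "alternating_on UNIV (length xs) (\<lambda>xs. \<omega> m (map ?f xs @ us))"
    if nz: "\<omega> m (map ?f xs @ us) \<noteq> 0"
  proof -
    have m: "m \<in> points A" using \<omega> nz by (auto simp: forms_def)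
    then have alt: "alternating_on (tangent_space A m) N (\<omega> m)" using \<omega> by (auto simp: forms_def)
    have T: "?f x \<in> tangent_space A m" for x using v(2)[of x] m by (auto simp: vector_fields_def)
    have l: "length xs + length us = N" and us: "set us \<subseteq> tangent_space A m"
      using alternating_on_support[OF alt, of "map ?f xs @ us"] nz by auto
    show ?thesis unfolding alternating_on_def
    proof (intro conjI allI impI)
      fix ys :: "'g list" assume "\<not> (length ys = length xs \<and> set ys \<subseteq> UNIV)"
      then show "\<omega> m (map ?f ys @ us) = 0" using l by (intro alternating_on_support[OF alt]) auto
    next
      fix ys :: "'g list" and i and x y :: 'g and a b :: real
      assume A: "length ys = length xs \<and> set ys \<subseteq> UNIV \<and> i < length xs \<and> x \<in> UNIV \<and> y \<in> UNIV"
      have f: "?f (a *\<^sub>R x + b *\<^sub>R y) = a *\<^sub>R ?f x + b *\<^sub>R ?f y"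
        using v(1) by (simp add: linear_add linear_scale)
      have "map ?f (ys[i := z]) @ us = (map ?f ys @ us)[i := ?f z]" for z :: 'g
        using A by (simp add: map_update list_update_append)
      then show "\<omega> m (map ?f (ys[i := a *\<^sub>R x + b *\<^sub>R y]) @ us) =
          a * \<omega> m (map ?f (ys[i := x]) @ us) + b * \<omega> m (map ?f (ys[i := y]) @ us)"
        using alternating_on_linear[OF alt, of "map ?f ys @ us" i "?f x" "?f y" a b] A l T us
        by (auto simp: f)
    next
      fix ys :: "'g list" assume "length ys = length xs \<and> set ys \<subseteq> UNIV \<and> \<not> distinct ys"
      then show "\<omega> m (map ?f ys @ us) = 0"
        by (intro alternating_on_repeated[OF alt]) (auto simp: distinct_map)
    qed
  qed
  then show "contract v \<omega> (wedge xs) m us = fold (\<lambda>x. interior_product (v x)) xs \<omega> m us"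
    by (auto simp: contract_def fold_interior_product wedge_def)
qed

definition zeta :: "nat \<Rightarrow> real" where
  "zeta k = - ((-1) ^ (k * (k + 1) div 2))"

definition homotopy_moment_map ::
  "('a, 'e::real_inner) chart set \<Rightarrow> nat \<Rightarrow> ('a, 'e) form \<Rightarrow> ('g::real_vector \<Rightarrow> 'g \<Rightarrow> 'g) \<Rightarrow>
   ('g \<Rightarrow> ('a, 'e) vfield) \<Rightarrow> (nat \<Rightarrow> 'g multivector \<Rightarrow> ('a, 'e) form) \<Rightarrow> bool" where
  "homotopy_moment_map A n \<omega> br v f \<longleftrightarrow>
     (\<forall>k\<in>{1..n}. linear_on (ext_power k) (f k) \<and> f k ` ext_power k \<subseteq> forms A (n - k)) \<and>
     f 0 = 0 \<and> f (n + 1) = 0 \<and>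
     (\<forall>k\<in>{1..n+1}. \<forall>p\<in>ext_power k.
        - f (k - 1) (lie_delta br p) = ext_deriv A (f k p) + zeta k *\<^sub>R contract v \<omega> p)"

definition weak_moment_map ::
  "('a, 'e::real_inner) chart set \<Rightarrow> nat \<Rightarrow> ('a, 'e) form \<Rightarrow> ('g::real_vector \<Rightarrow> 'g \<Rightarrow> 'g) \<Rightarrow>
   ('g \<Rightarrow> ('a, 'e) vfield) \<Rightarrow> (nat \<Rightarrow> 'g multivector \<Rightarrow> ('a, 'e) form) \<Rightarrow> bool" where
  "weak_moment_map A n \<omega> br v f \<longleftrightarrow>
     (\<forall>k\<in>{1..n}. linear_on (lie_kernel br k) (f k) \<and> f k ` lie_kernel br k \<subseteq> forms A (n - k)) \<and>
     (\<forall>k\<in>{1..n}. \<forall>p\<in>lie_kernel br k. ext_deriv A (f k p) = - zeta k *\<^sub>R contract v \<omega> p)"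

end

theory Submission
  imports Defs
begin

text \<open>A homotopy moment map restricts to a weak one, and its last equation is the vanishing of
  \<open>\<phi>\<close>.  Conversely, split \<open>\<Lambda>\<^sup>k = B\<^sub>k \<oplus> H\<^sub>k \<oplus> C\<^sub>k\<close>, where \<open>B\<^sub>k\<close> are the boundaries,
  \<open>P\<^sub>k = B\<^sub>k \<oplus> H\<^sub>k\<close> is the kernel of \<open>\<delta>\<close>, and \<open>\<delta>\<close> maps \<open>C\<^sub>k\<close> isomorphically
  onto \<open>B\<^bsub>k-1\<^esub>\<close>.  A weak moment map is kept on \<open>H\<^sub>k\<close> only; on \<open>C\<^sub>k\<close> the new map is \<open>0\<close>,
  and on \<open>B\<^sub>k\<close> the equation of degree \<open>k + 1\<close> then forces the value
  \<open>- \<zeta>(k+1) \<iota>(v\<^sub>p) \<omega>\<close> at \<open>\<delta> p\<close> for \<open>p \<in> C\<^bsub>k+1\<^esub>\<close>.  The equation of degree \<open>k\<close> on \<open>B\<^sub>k\<close>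
  is the identity \<open>d (\<iota>(v\<^sub>p) \<omega>) = (-1)\<^sup>k \<iota>(v\<^bsub>\<delta> p\<^esub>) \<omega>\<close> for \<open>p \<in> \<Lambda>\<^sup>k\<close>, which follows from
  Cartan's formula because \<open>\<omega>\<close> is closed and preserved by the action.\<close>

section \<open>Alternating forms\<close>

lemma alternating_on_zero: "alternating_on S k (\<lambda>xs. 0)"
  by (simp add: alternating_on_def)

lemma alternating_on_add_entry:
  assumes "alternating_on UNIV k \<alpha>"
  shows "\<alpha> (ys @ (a *\<^sub>R x + b *\<^sub>R y) # zs) = a * \<alpha> (ys @ x # zs) + b * \<alpha> (ys @ y # zs)"
proof (cases "length (ys @ x # zs) = k")
  case True
  then show ?thesis
    using alternating_on_linear[OF assms, of "ys @ x # zs" "length ys" x y a b] by simp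
next
  case False
  then show ?thesis using alternating_on_support[OF assms] by simp
qed

lemma alternating_on_minus_entry:
  assumes "alternating_on UNIV k \<alpha>"
  shows "\<alpha> (ys @ (- x) # zs) = - \<alpha> (ys @ x # zs)"
  using alternating_on_add_entry[OF assms, of ys "-1" x 0 0 zs] by simp

lemma alternating_on_swap:
  assumes "alternating_on UNIV k \<alpha>"
  shows "\<alpha> (ys @ a # b # zs) = - \<alpha> (ys @ b # a # zs)"
proof -
  note lin = alternating_on_add_entry[OF assms, where a = 1 and b = 1, simplified]
  have rep: "\<alpha> (ys @ w # w # zs) = 0" for w
    by (rule alternating_on_repeated[OF assms]) simp
  have "0 = \<alpha> (ys @ (a + b) # (a + b) # zs)"
    using rep by simp
  also have "\<dots> = \<alpha> (ys @ a # a # zs) + \<alpha> (ys @ a # b # zs) + (\<alpha> (ys @ b # a # zs) + \<alpha> (ys @ b # b # zs))"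
    using lin[of ys a b "(a + b) # zs"] lin[of "ys @ [a]" a b zs] lin[of "ys @ [b]" a b zs] by simp
  finally show ?thesis using rep by simp
qed

text \<open>One adjacent swap per entry of \<open>ys\<close>. The prefix \<open>ps\<close> is
  arbitrary in the induction because it takes up the entries already passed.\<close>

lemma alternating_on_move:
  assumes "alternating_on UNIV k \<alpha>"
  shows "\<alpha> (ps @ z # ys @ zs) = (- 1) ^ length ys * \<alpha> (ps @ ys @ z # zs)"
proof (induction ys arbitrary: ps)
  case (Cons y ys)
  have "\<alpha> (ps @ z # (y # ys) @ zs) = - \<alpha> ((ps @ [y]) @ z # ys @ zs)"
    using alternating_on_swap[OF assms, of ps z y "ys @ zs"] by simp
  then show ?case using Cons.IH[of "ps @ [y]"] by simp
qed simp

lemma nths_remove: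
  assumes "i < length xs"
  shows "nths xs (- {i}) = take i xs @ drop (Suc i) xs"
proof -
  have "xs = take i xs @ xs ! i # drop (Suc i) xs" using assms by (simp add: id_take_nth_drop)
  moreover have "nths (take i xs @ xs ! i # drop (Suc i) xs) (- {i}) = take i xs @ drop (Suc i) xs"
  proof -
    have "nths (take i xs) (- {i}) = take i xs" by (rule nths_all) auto
    moreover have "nths (drop (Suc i) xs) UNIV = drop (Suc i) xs" by (rule nths_all) auto
    ultimately show ?thesis using assms by (simp add: nths_append nths_Cons)
  qed
  ultimately show ?thesis by metis
qed

text \<open>Converts a bracket at the head of a list, as in the homology differential, into a
  bracket in its own slot, as in a Lie derivative.\<close>

lemma alternating_on_update:
  assumes "alternating_on UNIV k \<alpha>" "i < length xs"
  shows "\<alpha> (xs[i := z]) = (- 1) ^ i * \<alpha> (z # nths xs (- {i}))"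
  using alternating_on_move[OF assms(1), of "[]" z "take i xs" "drop (Suc i) xs"] assms(2)
  by (simp add: nths_remove upd_conv_take_nth_drop mult.assoc[symmetric] power_mult_distrib[symmetric])

text \<open>Contraction on the last arguments. If \<open>us\<close> is longer than \<open>k\<close>,
  the truncated degree is 0 and so is the form.\<close>

lemma alternating_on_append:
  assumes "alternating_on UNIV k \<alpha>"
  shows "alternating_on UNIV (k - length us) (\<lambda>xs. \<alpha> (xs @ us))"
proof (rule alternating_onI_adjacent)
  fix xs :: "'a list" and i x y a b
  assume "length xs = k - length us" "i < k - length us"
  then show "\<alpha> (xs[i := a *\<^sub>R x + b *\<^sub>R y] @ us) = a * \<alpha> (xs[i := x] @ us) + b * \<alpha> (xs[i := y] @ us)"
    using alternating_on_linear[OF assms, of "xs @ us" i x y a b] by (simp add: list_update_append)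
next
  fix xs :: "'a list" and i
  assume "length xs = k - length us" "Suc i < k - length us" "xs ! i = xs ! Suc i"
  then have "\<not> distinct xs"
    using nth_eq_iff_index_eq[of xs i "Suc i"] by auto
  then show "\<alpha> (xs @ us) = 0" by (intro alternating_on_repeated[OF assms]) simp
next
  fix xs :: "'a list"
  assume "length xs \<noteq> k - length us"
  then show "\<alpha> (xs @ us) = 0" by (intro alternating_on_support[OF assms]) auto
qed

lemma alternating_on_add:
  "alternating_on S k \<alpha> \<Longrightarrow> alternating_on S k \<beta> \<Longrightarrow> alternating_on S k (\<alpha> + \<beta>)"
  unfolding alternating_on_def by (simp add: algebra_simps)

lemma alternating_on_scaleR:
  "alternating_on S k \<alpha> \<Longrightarrow> alternating_on S k (r *\<^sub>R \<alpha>)"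
  unfolding alternating_on_def by (simp add: algebra_simps)

lemma alternating_on_Cons:
  fixes w :: "'b::real_vector"
  assumes "alternating_on S (Suc k) \<alpha>" "w \<in> S"
  shows "alternating_on S k (\<lambda>us. \<alpha> (w # us))"
  unfolding alternating_on_def
proof (intro conjI allI impI)
  fix xs i and x y :: 'b and a b :: real
  assume "length xs = k \<and> set xs \<subseteq> S \<and> i < k \<and> x \<in> S \<and> y \<in> S"
  then show "\<alpha> (w # xs[i := a *\<^sub>R x + b *\<^sub>R y]) = a * \<alpha> (w # xs[i := x]) + b * \<alpha> (w # xs[i := y])"
    using alternating_on_linear[OF assms(1), of "w # xs" "Suc i" x y a b] assms(2) by simp
next
  fix us assume "\<not> (length us = k \<and> set us \<subseteq> S)"
  then show "\<alpha> (w # us) = 0" by (intro alternating_on_support[OF assms(1)]) auto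
next
  fix us assume "length us = k \<and> set us \<subseteq> S \<and> \<not> distinct us"
  then show "\<alpha> (w # us) = 0" by (intro alternating_on_repeated[OF assms(1)]) simp
qed

lemma alternating_on_pullback:
  fixes f :: "'b::real_vector \<Rightarrow> 'c::real_vector"
  assumes "alternating_on S k \<alpha>" "linear f" "\<And>x. f x \<in> S"
  shows "alternating_on UNIV k (\<lambda>xs. \<alpha> (map f xs))"
  unfolding alternating_on_def
proof (intro conjI allI impI)
  fix xs :: "'b list" and i and x y :: 'b and a b :: real
  assume "length xs = k \<and> set xs \<subseteq> UNIV \<and> i < k \<and> x \<in> UNIV \<and> y \<in> UNIV"
  then show "\<alpha> (map f (xs[i := a *\<^sub>R x + b *\<^sub>R y])) = a * \<alpha> (map f (xs[i := x])) + b * \<alpha> (map f (xs[i := y]))"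
    using alternating_on_linear[OF assms(1), of "map f xs" i "f x" "f y" a b] assms(3)
    by (auto simp: map_update linear_add[OF assms(2)] linear_scale[OF assms(2)])
next
  fix xs :: "'b list" assume "\<not> (length xs = k \<and> set xs \<subseteq> UNIV)"
  then show "\<alpha> (map f xs) = 0" by (intro alternating_on_support[OF assms(1)]) auto
next
  fix xs :: "'b list" assume "length xs = k \<and> set xs \<subseteq> UNIV \<and> \<not> distinct xs"
  then show "\<alpha> (map f xs) = 0" by (intro alternating_on_repeated[OF assms(1)]) (simp add: distinct_map)
qed

lemma alternating_on_linear_entry:
  assumes "alternating_on UNIV k \<alpha>"
  shows "linear (\<lambda>e. \<alpha> (ys @ e # zs))"
  using alternating_on_add_entry[OF assms, of ys 1 _ 1 _ zs]
    alternating_on_add_entry[OF assms, of ys _ _ 0 0 zs]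
  by (intro linearI) simp_all

section \<open>The Chevalley--Eilenberg differential\<close>

text \<open>The transposes of the homology differential and of the adjoint action, on alternating forms.
  Recursion is on the last argument of a form, where \<open>(D \<alpha>)(xs, x)\<close> splits into
  \<open>D (\<iota>\<^sub>x \<alpha>) xs\<close> and a Lie derivative of \<open>\<alpha>\<close>, so that all identities follow by
  Cartan calculus.\<close>

definition ce_diff :: "('g::real_vector \<Rightarrow> 'g \<Rightarrow> 'g) \<Rightarrow> ('g list \<Rightarrow> real) \<Rightarrow> 'g list \<Rightarrow> real" where
  "ce_diff br \<alpha> xs =
     (\<Sum>j<length xs. \<Sum>i<j. (-1) ^ (i + j) * \<alpha> (br (xs ! i) (xs ! j) # nths xs (- {i, j})))"

definition ad_form :: "('g::real_vector \<Rightarrow> 'g \<Rightarrow> 'g) \<Rightarrow> 'g \<Rightarrow> ('g list \<Rightarrow> real) \<Rightarrow> 'g list \<Rightarrow> real" where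
  "ad_form br x \<alpha> xs = (\<Sum>i<length xs. \<alpha> (xs[i := br x (xs ! i)]))"

text \<open>A form of degree \<open>k\<close> is 0 on lists of any other length, so both sides
  vanish when \<open>xs\<close> has the wrong length.\<close>

lemma wedge_apply:
  assumes "alternating_on UNIV k \<alpha>"
  shows "wedge xs \<alpha> = \<alpha> xs"
  using assms alternating_on_support[OF assms, of xs] by (cases "length xs = k") (auto simp: wedge_def)

lemma delta_decomposable_apply:
  assumes "alternating_on UNIV k \<alpha>"
  shows "delta_decomposable br xs \<alpha> = ce_diff br \<alpha> xs"
  by (simp add: delta_decomposable_def ce_diff_def sum_fun_apply wedge_apply[OF assms])

text \<open>The summands evaluate the form on lists one entry shorter than \<open>xs\<close>. A sign
  depending on the length of the argument may therefore be treated as a constant.\<close>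

lemma ce_diff_cong:
  assumes "\<And>ys. Suc (length ys) = length xs \<Longrightarrow> \<alpha> ys = \<beta> ys"
  shows "ce_diff br \<alpha> xs = ce_diff br \<beta> xs"
proof -
  have "Suc (length (br (xs ! i) (xs ! j) # nths xs (- {i, j}))) = length xs"
    if "i < j" "j < length xs" for i j
    using that length_nths_two[OF that] by simp
  then show ?thesis
    unfolding ce_diff_def by (intro sum.cong refl arg_cong2[where f = "(*)"] assms) simp
qed

lemma ce_diff_add_scale:
  "ce_diff br (\<lambda>ys. \<alpha> ys + c * \<beta> ys) xs = ce_diff br \<alpha> xs + c * ce_diff br \<beta> xs"
  by (simp add: ce_diff_def algebra_simps sum.distrib sum_distrib_left)

lemma ad_form_add_scale:
  "ad_form br x (\<lambda>ys. \<alpha> ys + c * \<beta> ys) xs = ad_form br x \<alpha> xs + c * ad_form br x \<beta> xs"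
  by (simp add: ad_form_def sum.distrib sum_distrib_left)

lemma ad_form_cong:
  "(\<And>ys. length ys = length xs \<Longrightarrow> \<alpha> ys = \<beta> ys) \<Longrightarrow> ad_form br x \<alpha> xs = ad_form br x \<beta> xs"
  by (simp add: ad_form_def)

text \<open>The summand of the last position is split off. With appending \<open>y\<close> read as a
  contraction, this is the rule for exchanging a Lie derivative with a contraction.\<close>

lemma ad_form_append:
  "ad_form br x \<alpha> (xs @ [y]) = ad_form br x (\<lambda>ys. \<alpha> (ys @ [y])) xs + \<alpha> (xs @ [br x y])"
  by (simp add: ad_form_def list_update_append nth_append)

section \<open>Cartan calculus for alternating forms on a Lie algebra\<close>

locale real_lie_algebra =
  fixes br :: "'g::real_vector \<Rightarrow> 'g \<Rightarrow> 'g"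
  assumes bilinear_br: "bilinear br" and br_self: "br x x = 0"
    and br_jacobi: "br x (br y z) + br y (br z x) + br z (br x y) = 0"
begin

lemma alternating_on_ce_diff:
  assumes "alternating_on UNIV k \<alpha>"
  shows "alternating_on UNIV (Suc k) (ce_diff br \<alpha>)"
  using alternating_delta[where br = br, OF bilinear_br br_self assms]
  by (simp add: delta_decomposable_apply[OF assms])

lemma br_antisym: "br y x = - br x y"
proof -
  have "br (x + y) (x + y) = 0" by (rule br_self)
  then show ?thesis
    using br_self[of x] br_self[of y]
    by (simp add: bilinear_ladd[OF bilinear_br] bilinear_radd[OF bilinear_br] eq_neg_iff_add_eq_0 add.commute)
qed

lemma alternating_on_ad_form:
  assumes \<alpha>: "alternating_on UNIV k \<alpha>"
  shows "alternating_on UNIV k (ad_form br x \<alpha>)"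
proof (rule alternating_onI_adjacent)
  fix xs :: "'g list"
  assume "length xs \<noteq> k"
  then show "ad_form br x \<alpha> xs = 0"
    unfolding ad_form_def by (intro sum.neutral ballI alternating_on_support[OF \<alpha>]) simp
next
  fix xs :: "'g list" and i y z a b
  assume xs: "length xs = k" "i < k"
  have "\<alpha> (xs[i := a *\<^sub>R y + b *\<^sub>R z, j := br x (xs[i := a *\<^sub>R y + b *\<^sub>R z] ! j)]) =
      a * \<alpha> (xs[i := y, j := br x (xs[i := y] ! j)]) + b * \<alpha> (xs[i := z, j := br x (xs[i := z] ! j)])"
    if "j < k" for j
  proof (cases "j = i")
    case True
    then show ?thesis
      using xs alternating_on_linear[OF \<alpha>, of xs i "br x y" "br x z" a b]
      by (simp add: bilinear_radd[OF bilinear_br] bilinear_rmul[OF bilinear_br])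
  next
    case False
    then show ?thesis
      using xs alternating_on_linear[OF \<alpha>, of "xs[j := br x (xs ! j)]" i y z a b]
      by (simp add: list_update_swap)
  qed
  then show "ad_form br x \<alpha> (xs[i := a *\<^sub>R y + b *\<^sub>R z]) =
      a * ad_form br x \<alpha> (xs[i := y]) + b * ad_form br x \<alpha> (xs[i := z])"
    using xs by (simp add: ad_form_def sum_distrib_left sum.distrib[symmetric])
next
  fix xs :: "'g list" and i
  assume xs: "length xs = k" "Suc i < k" "xs ! i = xs ! Suc i"
  then obtain ys w zs where d: "xs = ys @ w # w # zs" "length ys = i"
    using split_equal_entries by metis
  \<comment> \<open>Updating any other position leaves the two equal entries in place. The two
    remaining summands cancel by a swap.\<close>
  have "\<alpha> (xs[j := br x (xs ! j)]) = 0" if "j \<noteq> i" "j \<noteq> Suc i" for j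
    using that xs nth_eq_iff_index_eq[of "xs[j := br x (xs ! j)]" i "Suc i"]
    by (intro alternating_on_repeated[OF \<alpha>]) auto
  then have "ad_form br x \<alpha> xs = (\<Sum>j\<in>{i, Suc i}. \<alpha> (xs[j := br x (xs ! j)]))"
    unfolding ad_form_def using xs by (intro sum.mono_neutral_right) auto
  also have "\<dots> = \<alpha> (ys @ br x w # w # zs) + \<alpha> (ys @ w # br x w # zs)"
    using d by (simp add: list_update_append nth_append)
  also have "\<dots> = 0"
    using alternating_on_swap[OF \<alpha>, of ys w "br x w" zs] by simp
  finally show "ad_form br x \<alpha> xs = 0" .
qed

text \<open>Cartan's formula as a recursion. Pairs inside \<open>xs\<close> give the differential of
  the form contracted with \<open>x\<close>; pairs with the last position give brackets with
  \<open>x\<close>, whose sign \<open>(- 1) ^ i\<close> is used up by moving the bracket from the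
  head back to slot \<open>i\<close>. The minus sign is antisymmetry of \<open>br\<close>.\<close>

lemma ce_diff_append:
  assumes \<alpha>: "alternating_on UNIV k \<alpha>"
  shows "ce_diff br \<alpha> (xs @ [x]) =
    ce_diff br (\<lambda>ys. \<alpha> (ys @ [x])) xs - (- 1) ^ length xs * ad_form br x \<alpha> xs"
proof -
  let ?l = "length xs"
  let ?zs = "xs @ [x]"
  define T where "T i j = (- 1) ^ (i + j) * \<alpha> (br (?zs ! i) (?zs ! j) # nths ?zs (- {i, j}))" for i j
  have "T i j = (- 1) ^ (i + j) * \<alpha> ((br (xs ! i) (xs ! j) # nths xs (- {i, j})) @ [x])"
    if "i < j" "j < ?l" for i j
    using that by (simp add: T_def nth_append nths_append)
  then have 1: "(\<Sum>j<?l. \<Sum>i<j. T i j) = ce_diff br (\<lambda>ys. \<alpha> (ys @ [x])) xs"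
    by (simp add: ce_diff_def)
  have "T i ?l = - ((- 1) ^ ?l * \<alpha> (xs[i := br x (xs ! i)]))" if i: "i < ?l" for i
  proof -
    have "nths ?zs (- {i, ?l}) = nths xs (- {i, ?l})"
      by (simp add: nths_append)
    also have "\<dots> = nths xs (- {i})"
      unfolding nths_def by (intro arg_cong[where f = "map fst"] filter_cong) (auto simp: set_zip)
    finally have "T i ?l = (- 1) ^ (i + ?l) * \<alpha> (br (xs ! i) x # nths xs (- {i}))"
      using i by (simp add: T_def nth_append)
    also have "\<dots> = - ((- 1) ^ (i + ?l) * \<alpha> (br x (xs ! i) # nths xs (- {i})))"
      using alternating_on_minus_entry[OF \<alpha>, of "[]"] br_antisym[of "xs ! i" x] by simp
    finally show ?thesis
      using alternating_on_update[OF \<alpha> i, of "br x (xs ! i)"] by (simp add: power_add)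
  qed
  then have "(\<Sum>i<?l. T i ?l) = - ((- 1) ^ ?l * ad_form br x \<alpha> xs)"
    by (simp add: ad_form_def sum_distrib_left sum_negf)
  moreover have "ce_diff br \<alpha> ?zs = (\<Sum>j<?l. \<Sum>i<j. T i j) + (\<Sum>i<?l. T i ?l)"
    by (simp add: ce_diff_def T_def)
  ultimately show ?thesis using 1 by simp
qed

text \<open>Transposes compose in reverse order, hence the order of \<open>x\<close> and
  \<open>y\<close>. After the last argument \<open>z\<close> is split off, the mixed terms cancel,
  the contracted form is handled by induction, and the Jacobi identity remains in the last
  slot.\<close>

lemma ad_form_commutator:
  assumes \<alpha>: "alternating_on UNIV k \<alpha>"
  shows "ad_form br y (ad_form br x \<alpha>) xs - ad_form br x (ad_form br y \<alpha>) xs = ad_form br (br x y) \<alpha> xs"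
  using \<alpha>
proof (induction xs arbitrary: k \<alpha> rule: rev_induct)
  case Nil
  then show ?case by (simp add: ad_form_def)
next
  case (snoc z xs)
  note add1 = ad_form_add_scale[where c = 1, simplified]
  have "br (br x y) z = br x (br y z) + (- 1) *\<^sub>R br y (br x z)"
  proof -
    have "br z (br x y) = - br (br x y) z" "br y (br z x) = - br y (br x z)"
      using br_antisym[of z "br x y"] br_antisym[of x z] bilinear_rneg[OF bilinear_br] by auto
    then show ?thesis using br_jacobi[of x y z] by (simp add: algebra_simps)
  qed
  then have "\<alpha> (xs @ [br (br x y) z]) = \<alpha> (xs @ [br x (br y z)]) - \<alpha> (xs @ [br y (br x z)])"
    using alternating_on_add_entry[OF snoc.prems, of xs 1 "br x (br y z)" "-1" "br y (br x z)" "[]"] by simp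
  moreover note snoc.IH[OF alternating_on_append[OF snoc.prems, of "[z]"]]
  ultimately show ?case
    by (simp add: ad_form_append add1)
qed

text \<open>Splitting off the last argument \<open>y\<close>, both sides contain the differential of
  the contraction with \<open>br x y\<close>. The contracted forms agree by induction, and the
  actions of \<open>x\<close> and \<open>y\<close> are exchanged by
  \<open>ad_form_commutator\<close>.\<close>

lemma ce_diff_ad_form:
  assumes \<alpha>: "alternating_on UNIV k \<alpha>"
  shows "ce_diff br (ad_form br x \<alpha>) xs = ad_form br x (ce_diff br \<alpha>) xs"
  using \<alpha>
proof (induction xs arbitrary: k \<alpha> rule: rev_induct)
  case Nil
  then show ?case by (simp add: ad_form_def ce_diff_def)
next
  case (snoc y xs)
  let ?i = "\<lambda>\<alpha> ys. \<alpha> (ys @ [y])" and ?s = "- ((- 1) ^ length xs) :: real"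
  note alt = snoc.prems alternating_on_ad_form[OF snoc.prems]
  note add1 = ce_diff_add_scale[where c = 1, simplified]
  have "ce_diff br (ad_form br x \<alpha>) (xs @ [y]) =
      ce_diff br (ad_form br x (?i \<alpha>)) xs + ce_diff br (\<lambda>ys. \<alpha> (ys @ [br x y])) xs +
      ?s * ad_form br y (ad_form br x \<alpha>) xs"
    using ce_diff_append[OF alt(2)] by (simp add: ad_form_append add1)
  \<comment> \<open>\<open>ad_form\<close> keeps the length of the list, so the sign in
    \<open>ce_diff_append\<close> is the constant \<open>?s\<close>.\<close>
  moreover have "ad_form br x (?i (ce_diff br \<alpha>)) xs =
      ad_form br x (\<lambda>ys. ce_diff br (?i \<alpha>) ys + ?s * ad_form br y \<alpha> ys) xs"
    by (rule ad_form_cong) (simp add: ce_diff_append[OF alt(1)])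
  moreover have "ad_form br y (ad_form br x \<alpha>) xs =
      ad_form br x (ad_form br y \<alpha>) xs + ad_form br (br x y) \<alpha> xs"
    using ad_form_commutator[where x = x and y = y and xs = xs, OF alt(1)] by simp
  moreover note snoc.IH[OF alternating_on_append[OF alt(1), of "[y]"]]
    ce_diff_append[OF alt(1), of xs "br x y"]
  ultimately show ?case
    unfolding ad_form_append ad_form_add_scale by (simp only: algebra_simps)
qed

text \<open>Splitting off the last argument twice leaves the contracted form, treated by induction,
  and two Lie derivative terms of opposite sign, which cancel by
  \<open>ce_diff_ad_form\<close>.\<close>

lemma ce_diff_ce_diff:
  assumes \<alpha>: "alternating_on UNIV k \<alpha>"
  shows "ce_diff br (ce_diff br \<alpha>) xs = 0"
  using \<alpha>
proof (induction xs arbitrary: k \<alpha> rule: rev_induct)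
  case Nil
  then show ?case by (simp add: ce_diff_def)
next
  case (snoc x xs)
  let ?i = "\<lambda>\<alpha> ys. \<alpha> (ys @ [x])" and ?s = "(- 1) ^ length xs :: real"
  have "ce_diff br (?i (ce_diff br \<alpha>)) xs =
      ce_diff br (\<lambda>ys. ce_diff br (?i \<alpha>) ys + ?s * ad_form br x \<alpha> ys) xs"
  proof (rule ce_diff_cong)
    fix ys :: "'g list" assume "Suc (length ys) = length xs"
    \<comment> \<open>The inner differential sees a list one entry shorter, which reverses the sign
      of \<open>ce_diff_append\<close>.\<close>
    then have "?s = - ((- 1) ^ length ys)" by (simp flip: \<open>Suc (length ys) = length xs\<close>)
    then show "ce_diff br \<alpha> (ys @ [x]) = ce_diff br (?i \<alpha>) ys + ?s * ad_form br x \<alpha> ys"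
      by (simp add: ce_diff_append[OF snoc.prems])
  qed
  then show ?case
    using snoc.IH[OF alternating_on_append[OF snoc.prems, of "[x]"]]
      ce_diff_append[OF alternating_on_ce_diff[OF snoc.prems], of xs x]
      ce_diff_ad_form[where x = x and xs = xs, OF snoc.prems]
    by (simp add: ce_diff_add_scale)
qed

end

section \<open>Smooth maps\<close>

lemma has_derivative_cong_open:
  assumes "open S" "x \<in> S" "\<And>y. y \<in> S \<Longrightarrow> f y = g y"
  shows "(f has_derivative D) (at x) \<longleftrightarrow> (g has_derivative D) (at x)"
  using has_derivative_transform_within_open[OF _ assms(1,2)] assms(3) by metis

text \<open>\<open>frechet_derivative\<close> is a choice among all derivatives, and both functions
  have the same ones; so the equality holds even where neither is differentiable.\<close>

lemma frechet_derivative_cong_open: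
  assumes "open S" "x \<in> S" "\<And>y. y \<in> S \<Longrightarrow> f y = g y"
  shows "frechet_derivative f (at x) = frechet_derivative g (at x)"
  using has_derivative_cong_open[OF assms] by (simp add: frechet_derivative_def)

lemma Ck_on_cong:
  assumes "open S" "\<And>y. y \<in> S \<Longrightarrow> f y = g y" "Ck_on k S f"
  shows "Ck_on k S g"
  using assms(2,3)
proof (induction k arbitrary: f g)
  case 0
  then show ?case using continuous_on_cong[of S S f g] by simp
next
  case (Suc k)
  have "g differentiable at x" if "x \<in> S" for x
  proof -
    have "(f has_derivative D) (at x) \<longleftrightarrow> (g has_derivative D) (at x)" for D
      by (rule has_derivative_cong_open[OF assms(1) that Suc.prems(1)])
    note g = this[symmetric]
    show ?thesis using Suc.prems(2) that by (simp add: differentiable_def g)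
  qed
  moreover have "Ck_on k S (\<lambda>x. frechet_derivative g (at x) e)" for e
    by (rule Suc.IH[where f = "\<lambda>x. frechet_derivative f (at x) e"])
      (use Suc.prems frechet_derivative_cong_open[OF assms(1) _ Suc.prems(1)] in auto)
  ultimately show ?case by simp
qed

lemma Ck_on_Suc_imp: "Ck_on (Suc k) S f \<Longrightarrow> Ck_on k S f"
proof (induction k arbitrary: f)
  case 0
  then show ?case
    by (auto intro!: continuous_at_imp_continuous_on differentiable_imp_continuous_within)
next
  case (Suc k)
  then show ?case by (metis Ck_on.simps(2))
qed

lemma Ck_on_const: "Ck_on k S (\<lambda>x. c)"
  by (induction k arbitrary: c) auto

lemma Ck_on_bounded_linear:
  assumes "bounded_linear h" "open S" "Ck_on k S f"
  shows "Ck_on k S (\<lambda>x. h (f x))"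
  using assms(3)
proof (induction k arbitrary: f)
  case 0
  then show ?case using bounded_linear.continuous_on[OF assms(1)] by simp
next
  case (Suc k)
  have D: "((\<lambda>x. h (f x)) has_derivative (\<lambda>e. h (frechet_derivative f (at x) e))) (at x)"
    if "x \<in> S" for x
    using Suc.prems that
    by (intro bounded_linear.has_derivative[OF assms(1)]) (simp add: frechet_derivative_works)
  have "Ck_on k S (\<lambda>x. frechet_derivative (\<lambda>x. h (f x)) (at x) e)" for e
    by (rule Ck_on_cong[OF assms(2) _ Suc.IH[of "\<lambda>x. frechet_derivative f (at x) e"]])
      (use Suc.prems frechet_derivative_at[OF D] in \<open>auto simp: fun_eq_iff\<close>)
  then show ?case using D by (auto simp: differentiable_def)
qed

lemma Ck_on_add:
  assumes "open S" "Ck_on k S f" "Ck_on k S g"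
  shows "Ck_on k S (\<lambda>x. f x + g x)"
  using assms(2,3)
proof (induction k arbitrary: f g)
  case 0
  then show ?case by (simp add: continuous_on_add)
next
  case (Suc k)
  have D: "((\<lambda>x. f x + g x) has_derivative
      (\<lambda>e. frechet_derivative f (at x) e + frechet_derivative g (at x) e)) (at x)" if "x \<in> S" for x
    using Suc.prems that by (intro has_derivative_add) (simp_all add: frechet_derivative_works)
  have "Ck_on k S (\<lambda>x. frechet_derivative (\<lambda>x. f x + g x) (at x) e)" for e
    by (rule Ck_on_cong[OF assms(1) _ Suc.IH[of "\<lambda>x. frechet_derivative f (at x) e"
            "\<lambda>x. frechet_derivative g (at x) e"]])
      (use Suc.prems frechet_derivative_at[OF D] in \<open>auto simp: fun_eq_iff\<close>)
  then show ?case using D by (auto simp: differentiable_def)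
qed

lemma Ck_on_mult:
  fixes f g :: "'e::real_normed_vector \<Rightarrow> real"
  assumes "open S" "Ck_on k S f" "Ck_on k S g"
  shows "Ck_on k S (\<lambda>x. f x * g x)"
  using assms(2,3)
proof (induction k arbitrary: f g)
  case 0
  then show ?case by (simp add: continuous_on_mult)
next
  case (Suc k)
  have D: "((\<lambda>x. f x * g x) has_derivative
      (\<lambda>e. f x * frechet_derivative g (at x) e + frechet_derivative f (at x) e * g x)) (at x)"
    if "x \<in> S" for x
    using Suc.prems that by (intro has_derivative_mult) (simp_all add: frechet_derivative_works)
  \<comment> \<open>The product rule keeps undifferentiated factors, which are of class
    \<open>k + 1\<close> and hence of class \<open>k\<close>, as the induction requires.\<close>
  have "Ck_on k S (\<lambda>x. f x * frechet_derivative g (at x) e + frechet_derivative f (at x) e * g x)" for e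
    using Suc.prems Ck_on_Suc_imp[OF Suc.prems(1)] Ck_on_Suc_imp[OF Suc.prems(2)]
    by (intro Ck_on_add[OF assms(1)] Suc.IH) auto
  then have "Ck_on k S (\<lambda>x. frechet_derivative (\<lambda>x. f x * g x) (at x) e)" for e
    by (rule Ck_on_cong[OF assms(1), rotated]) (use frechet_derivative_at[OF D] in \<open>auto simp: fun_eq_iff\<close>)
  then show ?case using D by (auto simp: differentiable_def)
qed

lemma smooth_on_cong: "open S \<Longrightarrow> (\<And>y. y \<in> S \<Longrightarrow> f y = g y) \<Longrightarrow> smooth_on S f \<Longrightarrow> smooth_on S g"
  unfolding smooth_on_def using Ck_on_cong by blast

lemma smooth_on_const: "smooth_on S (\<lambda>x. c)"
  by (simp add: smooth_on_def Ck_on_const)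

lemma smooth_on_add: "open S \<Longrightarrow> smooth_on S f \<Longrightarrow> smooth_on S g \<Longrightarrow> smooth_on S (\<lambda>x. f x + g x)"
  by (simp add: smooth_on_def Ck_on_add)

lemma smooth_on_mult:
  fixes f g :: "'e::real_normed_vector \<Rightarrow> real"
  shows "open S \<Longrightarrow> smooth_on S f \<Longrightarrow> smooth_on S g \<Longrightarrow> smooth_on S (\<lambda>x. f x * g x)"
  by (simp add: smooth_on_def Ck_on_mult)

lemma smooth_on_bounded_linear:
  "bounded_linear h \<Longrightarrow> open S \<Longrightarrow> smooth_on S f \<Longrightarrow> smooth_on S (\<lambda>x. h (f x))"
  by (simp add: smooth_on_def Ck_on_bounded_linear)

lemma smooth_on_sum:
  "open S \<Longrightarrow> (\<And>i. i \<in> I \<Longrightarrow> smooth_on S (f i)) \<Longrightarrow> smooth_on S (\<lambda>x. \<Sum>i\<in>I. f i x)"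
  by (induction I rule: infinite_finite_induct) (auto intro: smooth_on_const smooth_on_add)

lemma smooth_on_differentiable: "smooth_on S f \<Longrightarrow> x \<in> S \<Longrightarrow> f differentiable at x"
  unfolding smooth_on_def by (metis Ck_on.simps(2))

text \<open>For an orthogonal spanning set the residual of the expansion is orthogonal to
  everything, itself included. Fixed coordinates later reduce forms with moving arguments to forms
  with constant ones.\<close>

lemma finite_spanning_coordinates:
  fixes B :: "'e::real_inner set"
  assumes "finite B" "span B = UNIV"
  shows "\<exists>C. \<forall>e::'e. e = (\<Sum>b\<in>C. (e \<bullet> b / (b \<bullet> b)) *\<^sub>R b)"
proof -
  obtain C :: "'e set" where C: "finite C" "span C = UNIV" "pairwise orthogonal C"
    using basis_orthogonal[OF assms(1)] unfolding assms(2) by blast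
  have "e = (\<Sum>b\<in>C. (e \<bullet> b / (b \<bullet> b)) *\<^sub>R b)" for e
  proof -
    let ?d = "e - (\<Sum>b\<in>C. (e \<bullet> b / (b \<bullet> b)) *\<^sub>R b)"
    have "orthogonal ?d c" if "c \<in> C" for c
    proof -
      \<comment> \<open>The set \<open>C\<close> may contain 0; for \<open>c = 0\<close> both sides
        are 0.\<close>
      have "(e \<bullet> b / (b \<bullet> b)) * (b \<bullet> c) = (if b = c then e \<bullet> c else 0)" if "b \<in> C" for b
        using C(3) \<open>c \<in> C\<close> that by (cases "c = 0") (auto simp: pairwise_def orthogonal_def)
      then have "(\<Sum>b\<in>C. (e \<bullet> b / (b \<bullet> b)) * (b \<bullet> c)) = e \<bullet> c"
        using C(1) \<open>c \<in> C\<close> by simp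
      then show ?thesis
        by (simp add: orthogonal_def inner_diff_left inner_sum_left)
    qed
    then have "orthogonal ?d ?d"
      using orthogonal_to_span[of ?d C ?d] C(2) by simp
    then show ?thesis by (simp add: orthogonal_self)
  qed
  then show ?thesis by blast
qed

section \<open>Charts and local representations of forms\<close>

lemma chart_atI: "m \<in> points A \<Longrightarrow> chart_at A m \<in> charts_at A m"
  unfolding chart_at_def by (rule someI_ex) (auto simp: points_def charts_at_def)

locale manifold =
  fixes X :: "'a topology" and A :: "('a, 'e::real_inner) chart set"
  assumes smooth_manifold: "smooth_manifold X A"
begin

lemma
  assumes "c \<in> A"
  shows chart_dom_open: "openin X (chart_dom c)"
    and coord_open: "open (coord c ` chart_dom c)"
    and coord_homeo: "homeomorphic_map (subtopology X (chart_dom c))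
      (top_of_set (coord c ` chart_dom c)) (coord c)"
  using smooth_manifold assms unfolding smooth_manifold_def by blast+

lemma coord_inj: "c \<in> A \<Longrightarrow> inj_on (coord c) (chart_dom c)"
  using homeomorphic_imp_injective_map[OF coord_homeo] openin_subset[OF chart_dom_open]
  by (simp add: Int_absorb1)

lemma param_coord [simp]: "c \<in> A \<Longrightarrow> m \<in> chart_dom c \<Longrightarrow> param c (coord c m) = m"
  by (simp add: coord_inj)

lemma overlap_open:
  assumes "c \<in> A" "c' \<in> A"
  shows "open (coord c ` (chart_dom c \<inter> chart_dom c'))"
proof -
  have "openin (subtopology X (chart_dom c)) (chart_dom c \<inter> chart_dom c')"
    using chart_dom_open[OF assms(2)] by (auto simp: openin_subtopology)
  then have "openin (top_of_set (coord c ` chart_dom c)) (coord c ` (chart_dom c \<inter> chart_dom c'))"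
    using homeomorphic_imp_open_map[OF coord_homeo[OF assms(1)]] by (auto simp: open_map_def)
  then show ?thesis
    using coord_open[OF assms(1)] by (simp add: openin_open_eq)
qed

section \<open>Transition maps and tangent vectors\<close>

lemma transition_has_derivative:
  assumes "c \<in> charts_at A m" "c' \<in> charts_at A m"
  shows "((coord c' \<circ> param c) has_derivative transition_deriv c c' m) (at (coord c m))"
proof -
  have "smooth_on (coord c ` (chart_dom c \<inter> chart_dom c')) (coord c' \<circ> param c)"
    using assms smooth_manifold by (auto simp: smooth_manifold_def charts_at_def)
  then have "(coord c' \<circ> param c) differentiable at (coord c m)"
    by (rule smooth_on_differentiable) (use assms in \<open>auto simp: charts_at_def\<close>)
  then show ?thesis by (simp add: transition_deriv_def frechet_derivative_works)
qed

lemma transition_cocycle: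
  assumes "c \<in> charts_at A m" "c' \<in> charts_at A m" "c'' \<in> charts_at A m"
  shows "transition_deriv c' c'' m (transition_deriv c c' m e) = transition_deriv c c'' m e"
proof -
  let ?S = "coord c ` (chart_dom c \<inter> chart_dom c')"
  have c: "c \<in> A" "c' \<in> A" "m \<in> chart_dom c" "m \<in> chart_dom c'" using assms by (auto simp: charts_at_def)
  have "((coord c'' \<circ> param c') \<circ> (coord c' \<circ> param c) has_derivative
      transition_deriv c' c'' m \<circ> transition_deriv c c' m) (at (coord c m))"
    by (rule diff_chain_at[OF transition_has_derivative])
      (use assms c transition_has_derivative[of c' m c''] in auto)
  \<comment> \<open>The chain of transition maps is known to equal the direct one only on the image
    of the overlap, an open neighbourhood of \<open>coord c m\<close>.\<close>
  then have "((coord c'' \<circ> param c) has_derivative transition_deriv c' c'' m \<circ> transition_deriv c c' m)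
      (at (coord c m))"
    by (rule has_derivative_transform_within_open[OF _ overlap_open[OF c(1,2)]]) (use c in auto)
  then show ?thesis
    using frechet_derivative_at by (metis comp_apply transition_deriv_def)
qed

lemma chart_vector_in_tangent_space:
  assumes "c \<in> charts_at A m"
  shows "chart_vector A c m e \<in> tangent_space A m"
  using transition_cocycle[OF assms] by (auto simp: tangent_space_def chart_vector_def)

lemma linear_chart_vector:
  assumes "c \<in> charts_at A m"
  shows "linear (chart_vector A c m)"
proof -
  have "linear (transition_deriv c c' m)" if "c' \<in> charts_at A m" for c'
    using has_derivative_linear[OF transition_has_derivative[OF assms that]] .
  then show ?thesis
    by (intro linearI) (auto simp: chart_vector_def fun_eq_iff linear_add linear_scale)
qed

text \<open>By the transition law one component determines a tangent vector. So values of a form can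
  be computed by \<open>local_form\<close> from the components of the arguments.\<close>

lemma chart_vector_component:
  assumes "c \<in> charts_at A m" "u \<in> tangent_space A m"
  shows "chart_vector A c m (u c) = u"
proof
  fix c'
  have "u c' = (if c' \<in> charts_at A m then transition_deriv c c' m (u c) else 0)"
  proof (cases "c' \<in> charts_at A m")
    case True
    then have "u c' = transition_deriv c c' m (u c)" using assms unfolding tangent_space_def by blast
    then show ?thesis by (subst if_P[OF True])
  next
    case False
    then have "u c' = 0" using assms(2) unfolding tangent_space_def by blast
    then show ?thesis by (subst if_not_P[OF False])
  qed
  then show "chart_vector A c m (u c) c' = u c'"
    unfolding chart_vector_def by (rule sym)
qed

lemma map_chart_vector_components:
  "c \<in> charts_at A m \<Longrightarrow> set us \<subseteq> tangent_space A m \<Longrightarrow>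
    map (chart_vector A c m) (map (\<lambda>u. u c) us) = us"
  by (auto simp: chart_vector_component intro!: map_idI)

section \<open>Differential forms in charts\<close>

lemma alternating_on_form: "\<alpha> \<in> forms A k \<Longrightarrow> m \<in> points A \<Longrightarrow> alternating_on (tangent_space A m) k (\<alpha> m)"
  by (simp add: forms_def)

lemma form_eq_0:
  assumes "\<alpha> \<in> forms A k" "m \<notin> points A \<or> \<not> set us \<subseteq> tangent_space A m"
  shows "\<alpha> m us = 0"
proof (cases "m \<in> points A")
  case True
  then show ?thesis
    using assms(2) by (intro alternating_on_support[OF alternating_on_form[OF assms(1)]]) auto
next
  case False
  then have "\<alpha> m = 0" using assms(1) by (simp add: forms_def)
  then show ?thesis by simp
qed

lemma param_in_charts:
  assumes "c \<in> A" "x \<in> coord c ` chart_dom c"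
  shows "c \<in> charts_at A (param c x)" "param c x \<in> points A"
  using assms by (auto simp: charts_at_def points_def)

lemma alternating_on_local_form:
  assumes "\<alpha> \<in> forms A k" "c \<in> A" "x \<in> coord c ` chart_dom c"
  shows "alternating_on UNIV k (local_form A c \<alpha> x)"
  unfolding local_form_def
proof (rule alternating_on_pullback)
  show "alternating_on (tangent_space A (param c x)) k (\<alpha> (param c x))"
    by (rule alternating_on_form) (use assms param_in_charts in auto)
qed (use param_in_charts(1)[OF assms(2,3)] in \<open>auto intro: linear_chart_vector chart_vector_in_tangent_space\<close>)

text \<open>Membership in \<open>forms\<close> gives smoothness for lists of length
  \<open>k\<close>; on other lists the local form is constantly 0.\<close>

lemma smooth_on_local_form:
  assumes "\<alpha> \<in> forms A k" "c \<in> A"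
  shows "smooth_on (coord c ` chart_dom c) (\<lambda>x. local_form A c \<alpha> x es)"
proof (cases "length es = k")
  case True
  then show ?thesis using assms by (auto simp: forms_def)
next
  case False
  have "0 = local_form A c \<alpha> x es" if "x \<in> coord c ` chart_dom c" for x
    using alternating_on_support[OF alternating_on_local_form[OF assms that]] False by simp
  then show ?thesis
    by (rule smooth_on_cong[OF coord_open[OF assms(2)] _ smooth_on_const])
qed

lemma local_form_has_derivative:
  assumes "\<alpha> \<in> forms A k" "c \<in> A" "x \<in> coord c ` chart_dom c"
  shows "((\<lambda>x. local_form A c \<alpha> x es) has_derivative
    frechet_derivative (\<lambda>x. local_form A c \<alpha> x es) (at x)) (at x)"
  using smooth_on_differentiable[OF smooth_on_local_form[OF assms(1,2)] assms(3)]
  by (simp add: frechet_derivative_works)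

lemma ex_component_coordinates: "\<exists>C. \<forall>e::'e. e = (\<Sum>b\<in>C. (e \<bullet> b / (b \<bullet> b)) *\<^sub>R b)"
proof -
  obtain B :: "'e set" where "finite B" "span B = UNIV"
    using smooth_manifold unfolding smooth_manifold_def by blast
  then show ?thesis by (rule finite_spanning_coordinates)
qed

lemma alternating_on_coordinates:
  fixes \<beta> :: "'e list \<Rightarrow> real" and C :: "'e set"
  assumes "alternating_on UNIV k \<beta>" and C: "\<forall>e. e = (\<Sum>b\<in>C. (e \<bullet> b / (b \<bullet> b)) *\<^sub>R b)"
  shows "\<beta> (e # es) = (\<Sum>b\<in>C. (e \<bullet> b / (b \<bullet> b)) * \<beta> (b # es))"
proof -
  have lin: "linear (\<lambda>e. \<beta> (e # es))" using alternating_on_linear_entry[OF assms(1), of "[]"] by simp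
  have "\<beta> (e # es) = \<beta> ((\<Sum>b\<in>C. (e \<bullet> b / (b \<bullet> b)) *\<^sub>R b) # es)"
    by (rule arg_cong[OF C[rule_format], of "\<lambda>e. \<beta> (e # es)"])
  also have "\<dots> = (\<Sum>b\<in>C. (e \<bullet> b / (b \<bullet> b)) * \<beta> (b # es))"
    using linear_sum[OF lin, of "\<lambda>b. (e \<bullet> b / (b \<bullet> b)) *\<^sub>R b" C] linear_scale[OF lin] by simp
  finally show ?thesis .
qed

text \<open>Expanding the moving argument in fixed coordinates gives a sum of products of a
  coefficient of \<open>W\<close> with a local form on constant arguments, to which the product rule
  applies.\<close>

lemma local_form_field_has_derivative:
  assumes "\<alpha> \<in> forms A k" "c \<in> A" "x \<in> coord c ` chart_dom c" and W: "(W has_derivative W') (at x)"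
  shows "((\<lambda>x. local_form A c \<alpha> x (W x # es)) has_derivative
    (\<lambda>e. frechet_derivative (\<lambda>y. local_form A c \<alpha> y (W x # es)) (at x) e +
         local_form A c \<alpha> x (W' e # es))) (at x)"
proof -
  let ?L = "local_form A c \<alpha>"
  let ?D = "\<lambda>es. frechet_derivative (\<lambda>y. ?L y es) (at x)"
  obtain C :: "'e set" where C: "\<forall>e. e = (\<Sum>b\<in>C. (e \<bullet> b / (b \<bullet> b)) *\<^sub>R b)"
    using ex_component_coordinates by blast
  note coords = alternating_on_coordinates[OF alternating_on_local_form[OF assms(1,2)] C]
  note L' = local_form_has_derivative[OF assms(1-3)]
  have general: "((\<lambda>x. ?L x (W x # es)) has_derivative
      (\<lambda>e. (\<Sum>b\<in>C. (W x \<bullet> b / (b \<bullet> b)) * ?D (b # es) e) + ?L x (W' e # es))) (at x)"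
    if W: "(W has_derivative W') (at x)" for W W'
  proof -
    have "((\<lambda>x. \<Sum>b\<in>C. (W x \<bullet> b / (b \<bullet> b)) * ?L x (b # es)) has_derivative
        (\<lambda>e. \<Sum>b\<in>C. (W x \<bullet> b / (b \<bullet> b)) * ?D (b # es) e + (W' e \<bullet> b / (b \<bullet> b)) * ?L x (b # es))) (at x)"
    proof (intro has_derivative_sum has_derivative_mult L')
      fix b :: 'e
      have "bounded_linear (\<lambda>w. w \<bullet> b / (b \<bullet> b))"
        by (rule bounded_linear_compose[OF bounded_linear_divide bounded_linear_inner_left])
      then show "((\<lambda>x. W x \<bullet> b / (b \<bullet> b)) has_derivative (\<lambda>e. W' e \<bullet> b / (b \<bullet> b))) (at x)"
        using W by (rule bounded_linear.has_derivative)
    qed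
    then have "((\<lambda>x. ?L x (W x # es)) has_derivative
        (\<lambda>e. \<Sum>b\<in>C. (W x \<bullet> b / (b \<bullet> b)) * ?D (b # es) e + (W' e \<bullet> b / (b \<bullet> b)) * ?L x (b # es))) (at x)"
      by (rule has_derivative_transform_within_open[OF _ coord_open[OF assms(2)] assms(3)])
        (simp add: coords[symmetric] del: times_divide_eq_left)
    then show ?thesis by (simp add: sum.distrib del: times_divide_eq_left flip: coords[OF assms(3)])
  qed
  have "?L x (0 # es) = 0"
    using linear_0[OF alternating_on_linear_entry[OF alternating_on_local_form[OF assms(1-3)], of "[]"]]
    by simp
  \<comment> \<open>A constant field has derivative 0, so \<open>general\<close> identifies the sum
    over \<open>C\<close> as the derivative with the argument frozen at \<open>W x\<close>.\<close>
  then have "?D (W x # es) = (\<lambda>e. \<Sum>b\<in>C. (W x \<bullet> b / (b \<bullet> b)) * ?D (b # es) e)"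
    using frechet_derivative_at[OF general[OF has_derivative_const[of "W x"]]] by simp
  then show ?thesis using general[OF W] by simp
qed

section \<open>Interior products and linearity of the exterior derivative\<close>

lemma vector_field_tangent: "V \<in> vector_fields A \<Longrightarrow> m \<in> points A \<Longrightarrow> V m \<in> tangent_space A m"
  by (simp add: vector_fields_def)

lemma local_form_interior_product:
  assumes "V \<in> vector_fields A" "c \<in> A" "x \<in> coord c ` chart_dom c"
  shows "local_form A c (interior_product V \<alpha>) x es = local_form A c \<alpha> x (V (param c x) c # es)"
  using chart_vector_component[OF param_in_charts(1)[OF assms(2,3)]
      vector_field_tangent[OF assms(1) param_in_charts(2)[OF assms(2,3)]]]
  by (simp add: local_form_def interior_product_def)

text \<open>For smoothness the field is expanded in fixed coordinates, so that only smooth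
  coefficients and local forms on constant arguments occur.\<close>

lemma interior_product_in_forms:
  assumes V: "V \<in> vector_fields A" and \<alpha>: "\<alpha> \<in> forms A (Suc k)"
  shows "interior_product V \<alpha> \<in> forms A k"
proof -
  have "smooth_on (coord c ` chart_dom c) (\<lambda>x. local_form A c (interior_product V \<alpha>) x es)"
    if c: "c \<in> A" for c es
  proof -
    obtain C :: "'e set" where C: "\<forall>e. e = (\<Sum>b\<in>C. (e \<bullet> b / (b \<bullet> b)) *\<^sub>R b)"
      using ex_component_coordinates by blast
    have "smooth_on (coord c ` chart_dom c)
        (\<lambda>x. \<Sum>b\<in>C. (V (param c x) c \<bullet> b / (b \<bullet> b)) * local_form A c \<alpha> x (b # es))"
    proof (intro smooth_on_sum smooth_on_mult coord_open[OF c] smooth_on_local_form[OF \<alpha> c])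
      fix b :: 'e
      have "bounded_linear (\<lambda>w. w \<bullet> b / (b \<bullet> b))"
        by (rule bounded_linear_compose[OF bounded_linear_divide bounded_linear_inner_left])
      then show "smooth_on (coord c ` chart_dom c) (\<lambda>x. V (param c x) c \<bullet> b / (b \<bullet> b))"
        by (rule smooth_on_bounded_linear[OF _ coord_open[OF c]])
          (use V c in \<open>simp add: vector_fields_def\<close>)
    qed
    then show ?thesis
      by (rule smooth_on_cong[OF coord_open[OF c], rotated])
        (simp add: local_form_interior_product[OF V c]
          alternating_on_coordinates[OF alternating_on_local_form[OF \<alpha> c] C, symmetric]
          del: times_divide_eq_left)
  qed
  then show ?thesis
    using \<alpha> alternating_on_Cons[OF alternating_on_form[OF \<alpha>] vector_field_tangent[OF V]]
    by (auto simp: forms_def interior_product_def fun_eq_iff)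
qed

lemma subspace_forms: "subspace (forms A k)"
proof (rule subspaceI)
  show "0 \<in> forms A k"
    using alternating_on_zero
    by (auto simp: forms_def local_form_def zero_fun_def smooth_on_const)
next
  fix \<alpha> \<beta> assume "\<alpha> \<in> forms A k" "\<beta> \<in> forms A k"
  then show "\<alpha> + \<beta> \<in> forms A k"
    by (auto simp: forms_def local_form_def alternating_on_add smooth_on_add coord_open)
next
  fix \<alpha> and r assume \<alpha>: "\<alpha> \<in> forms A k"
  then show "r *\<^sub>R \<alpha> \<in> forms A k"
    by (auto simp: forms_def local_form_def alternating_on_scaleR smooth_on_mult smooth_on_const coord_open)
qed

lemma ext_deriv_linear:
  assumes "\<alpha> \<in> forms A k" "\<beta> \<in> forms A k"
  shows "ext_deriv A (a *\<^sub>R \<alpha> + b *\<^sub>R \<beta>) = a *\<^sub>R ext_deriv A \<alpha> + b *\<^sub>R ext_deriv A \<beta>"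
proof (intro ext)
  fix m and us :: "('a, 'e) tangent list"
  show "ext_deriv A (a *\<^sub>R \<alpha> + b *\<^sub>R \<beta>) m us = (a *\<^sub>R ext_deriv A \<alpha> + b *\<^sub>R ext_deriv A \<beta>) m us"
  proof (cases "m \<in> points A \<and> set us \<subseteq> tangent_space A m")
    case True
    let ?c = "chart_at A m"
    have c: "?c \<in> A" "coord ?c m \<in> coord ?c ` chart_dom ?c"
      using True chart_atI[of m A] by (auto simp: charts_at_def)
    have D: "((\<lambda>x. local_form A ?c (a *\<^sub>R \<alpha> + b *\<^sub>R \<beta>) x es) has_derivative
       (\<lambda>e. a * frechet_derivative (\<lambda>x. local_form A ?c \<alpha> x es) (at (coord ?c m)) e +
         b * frechet_derivative (\<lambda>x. local_form A ?c \<beta> x es) (at (coord ?c m)) e)) (at (coord ?c m))" for es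
      using has_derivative_add[OF has_derivative_mult_right[OF local_form_has_derivative[OF assms(1) c]]
          has_derivative_mult_right[OF local_form_has_derivative[OF assms(2) c]]]
      by (simp add: local_form_def)
    then show ?thesis
      using True
      by (simp add: ext_deriv_def Let_def frechet_derivative_at[OF D, symmetric] sum_distrib_left
          sum.distrib[symmetric] algebra_simps)
  qed (auto simp: ext_deriv_def)
qed

lemma ext_deriv_zero: "ext_deriv A 0 = 0"
  using ext_deriv_linear[OF subspace_0[OF subspace_forms] subspace_0[OF subspace_forms], where a = 0 and b = 0]
  by simp

lemma vector_field_has_derivative:
  assumes "V \<in> vector_fields A" "c \<in> A" "x \<in> coord c ` chart_dom c"
  shows "((\<lambda>x. V (param c x) c) has_derivative frechet_derivative (\<lambda>x. V (param c x) c) (at x)) (at x)"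
  using assms smooth_on_differentiable[of "coord c ` chart_dom c" "\<lambda>x. V (param c x) c" x]
  by (simp add: vector_fields_def frechet_derivative_works)

end

section \<open>Cartan calculus\<close>

context manifold
begin

lemma interior_product_frechet_derivative:
  assumes V: "V \<in> vector_fields A" and \<alpha>: "\<alpha> \<in> forms A k" and c: "c \<in> charts_at A m"
  shows "frechet_derivative (\<lambda>x. local_form A c (interior_product V \<alpha>) x es) (at (coord c m)) e =
    frechet_derivative (\<lambda>x. local_form A c \<alpha> x (V m c # es)) (at (coord c m)) e +
    local_form A c \<alpha> (coord c m) (frechet_derivative (\<lambda>x. V (param c x) c) (at (coord c m)) e # es)"
proof -
  have cA: "c \<in> A" "coord c m \<in> coord c ` chart_dom c" "param c (coord c m) = m"
    using c by (auto simp: charts_at_def)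
  have "frechet_derivative (\<lambda>x. local_form A c (interior_product V \<alpha>) x es) (at (coord c m)) =
      frechet_derivative (\<lambda>x. local_form A c \<alpha> x (V (param c x) c # es)) (at (coord c m))"
    by (rule frechet_derivative_cong_open[OF coord_open[OF cA(1)] cA(2)])
      (rule local_form_interior_product[OF V cA(1)])
  then show ?thesis
    using fun_cong[OF frechet_derivative_at[OF local_form_field_has_derivative[OF \<alpha> cA(1,2)
          vector_field_has_derivative[OF V cA(1,2)], of es]], of e] cA(3) by simp
qed

text \<open>All three terms use the same chart at \<open>m\<close>. The product rule splits the left
  side into \<open>R\<close>, where the coefficients of the form are differentiated, and terms in
  \<open>DV\<close>; the latter are exactly those of the Lie derivative.\<close>

lemma cartan_formula:
  assumes V: "V \<in> vector_fields A" and \<alpha>: "\<alpha> \<in> forms A k"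
  shows "ext_deriv A (interior_product V \<alpha>) m us = lie_deriv A V \<alpha> m us - ext_deriv A \<alpha> m (V m # us)"
proof (cases "m \<in> points A \<and> set us \<subseteq> tangent_space A m")
  case True
  define c where "c = chart_at A m"
  have c: "c \<in> charts_at A m" using True by (simp add: c_def chart_atI)
  then have cA: "c \<in> A" "coord c m \<in> coord c ` chart_dom c" by (auto simp: charts_at_def)
  define es where "es = map (\<lambda>u. u c) us"
  define L where "L = local_form A c \<alpha> (coord c m)"
  define D where "D es = frechet_derivative (\<lambda>x. local_form A c \<alpha> x es) (at (coord c m))" for es
  define DV where "DV = frechet_derivative (\<lambda>x. V (param c x) c) (at (coord c m))"
  define R where "R = (\<Sum>i<length es. (- 1) ^ i * D (V m c # nths es (- {i})) (es ! i))"
  have alt: "alternating_on UNIV k L" unfolding L_def by (rule alternating_on_local_form[OF \<alpha> cA])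
  have "ext_deriv A (interior_product V \<alpha>) m us =
      (\<Sum>i<length es. (- 1) ^ i * (D (V m c # nths es (- {i})) (es ! i) + L (DV (es ! i) # nths es (- {i}))))"
    using True by (simp add: ext_deriv_def Let_def interior_product_frechet_derivative[OF V \<alpha> c]
        del: nth_map length_map flip: c_def es_def DV_def D_def L_def)
  \<comment> \<open>The alternating sign moves \<open>DV (es ! i)\<close> from the head of the list
    to slot \<open>i\<close>.\<close>
  also have "\<dots> = R + (\<Sum>i<length es. L (es[i := DV (es ! i)]))"
    by (simp add: R_def alternating_on_update[OF alt] distrib_left sum.distrib)
  finally have 1: "ext_deriv A (interior_product V \<alpha>) m us = R + (\<Sum>i<length es. L (es[i := DV (es ! i)]))" .
  have 2: "lie_deriv A V \<alpha> m us = D es (V m c) + (\<Sum>i<length es. L (es[i := DV (es ! i)]))"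
    using True by (simp add: lie_deriv_def Let_def del: nth_map length_map flip: c_def es_def DV_def D_def L_def)
  have "ext_deriv A \<alpha> m (V m # us) =
      (\<Sum>i<Suc (length es). (- 1) ^ i * D (nths (V m c # es) (- {i})) ((V m c # es) ! i))"
    using True vector_field_tangent[OF V] by (simp add: ext_deriv_def Let_def del: nth_map length_map flip: c_def es_def D_def)
  \<comment> \<open>The summand 0 differentiates along \<open>V\<close>; in the others the index is
    shifted by one, which flips the sign of \<open>R\<close>.\<close>
  also have "\<dots> = D es (V m c) - R"
  proof -
    have "nths es {i. Suc i \<noteq> 0} = es" by (rule nths_all) auto
    moreover have "{j. Suc j \<noteq> Suc i} = - {i}" for i :: nat by auto
    ultimately show ?thesis
      unfolding sum.lessThan_Suc_shift R_def by (simp add: nths_Cons sum_negf)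
  qed
  finally show ?thesis using 1 2 by simp
qed (auto simp: ext_deriv_def lie_deriv_def)

text \<open>The left side has \<open>DW (V m c)\<close> in the slot of \<open>W\<close>, from the
  product rule, where the Lie derivative of \<open>\<alpha>\<close> has \<open>DV (W m c)\<close>.
  Their difference is the bracket; the assumption \<open>VW\<close> provides that its value is
  tangent.\<close>

lemma lie_deriv_interior_product:
  assumes V: "V \<in> vector_fields A" and W: "W \<in> vector_fields A" and VW: "lie_bracket A V W \<in> vector_fields A"
    and \<alpha>: "\<alpha> \<in> forms A k"
  shows "lie_deriv A V (interior_product W \<alpha>) m us =
    lie_deriv A V \<alpha> m (W m # us) + \<alpha> m (lie_bracket A V W m # us)"
proof (cases "m \<in> points A \<and> set us \<subseteq> tangent_space A m")
  case True
  define c where "c = chart_at A m"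
  have c: "c \<in> charts_at A m" using True by (simp add: c_def chart_atI)
  then have cA: "c \<in> A" "coord c m \<in> coord c ` chart_dom c" "param c (coord c m) = m"
    by (auto simp: charts_at_def)
  define es where "es = map (\<lambda>u. u c) us"
  define L where "L = local_form A c \<alpha> (coord c m)"
  define D where "D es = frechet_derivative (\<lambda>x. local_form A c \<alpha> x es) (at (coord c m))" for es
  define DV where "DV = frechet_derivative (\<lambda>x. V (param c x) c) (at (coord c m))"
  define DW where "DW = frechet_derivative (\<lambda>x. W (param c x) c) (at (coord c m))"
  have alt: "alternating_on UNIV k L" unfolding L_def by (rule alternating_on_local_form[OF \<alpha> cA(1,2)])
  have 1: "lie_deriv A V (interior_product W \<alpha>) m us = D (W m c # es) (V m c) + L (DW (V m c) # es) +
      (\<Sum>i<length es. L (W m c # es[i := DV (es ! i)]))"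
    using True cA by (simp add: lie_deriv_def Let_def interior_product_frechet_derivative[OF W \<alpha> c]
        local_form_interior_product[OF W] del: nth_map length_map flip: c_def es_def DV_def DW_def D_def L_def)
  have 2: "lie_deriv A V \<alpha> m (W m # us) = D (W m c # es) (V m c) + (L (DV (W m c) # es) +
      (\<Sum>i<length es. L (W m c # es[i := DV (es ! i)])))"
  proof -
    have "lie_deriv A V \<alpha> m (W m # us) = D (W m c # es) (V m c) +
      (\<Sum>i<Suc (length es). L ((W m c # es)[i := DV ((W m c # es) ! i)]))"
      using True vector_field_tangent[OF W]
      by (simp add: lie_deriv_def Let_def c_def es_def DV_def D_def L_def del: sum.lessThan_Suc)
    then show ?thesis unfolding sum.lessThan_Suc_shift by simp
  qed
  have "lie_bracket A V W m c = DW (V m c) - DV (W m c)"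
    using c by (simp add: lie_bracket_def DW_def DV_def)
  moreover have "\<alpha> m (lie_bracket A V W m # us) = L (lie_bracket A V W m c # es)"
    using True chart_vector_component[OF c vector_field_tangent[OF VW]] map_chart_vector_components[OF c, of us]
    by (simp add: L_def local_form_def cA es_def del: map_map)
  moreover have "L ((DW (V m c) - DV (W m c)) # es) = L (DW (V m c) # es) - L (DV (W m c) # es)"
    using linear_diff[OF alternating_on_linear_entry[OF alt, of "[]" es]] by simp
  ultimately show ?thesis using 1 2 by simp
qed (auto simp: lie_deriv_def form_eq_0[OF \<alpha>])

end

section \<open>Contraction with multivectors\<close>

lemma linear_contract: "linear (contract v \<omega>)"
  by (rule linearI) (auto simp: contract_def fun_eq_iff)

lemma linear_lie_delta: "linear (lie_delta br)"
  by (rule linearI) (auto simp: lie_delta_def fun_eq_iff)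

lemma subspace_ext_power: "subspace (ext_power k)"
  by (simp add: ext_power_def)

lemma wedge_in_ext_power: "length xs = k \<Longrightarrow> wedge xs \<in> ext_power k"
  by (auto simp: ext_power_def intro: span_base)

text \<open>Induction on multivectors: decomposables span. With \<open>T = {0}\<close> it shows that
  a linear map vanishes, and with a pair-valued \<open>f\<close> it propagates a linear
  relation.\<close>

lemma linear_image_ext_power:
  assumes "linear f" "subspace T" "\<And>xs. length xs = k \<Longrightarrow> f (wedge xs) \<in> T" "p \<in> ext_power k"
  shows "f p \<in> T"
proof -
  have "ext_power k \<subseteq> f -` T"
    unfolding ext_power_def
  proof (rule span_minimal)
    show "{wedge xs |xs. length xs = k} \<subseteq> f -` T" using assms(3) by blast
    show "subspace (f -` T)" by (rule linear_subspace_vimage[OF assms(1,2)])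
  qed
  then show ?thesis using assms(4) by blast
qed

lemma delta_decomposable_in_ext_power:
  assumes "length xs = Suc k"
  shows "delta_decomposable br xs \<in> ext_power k"
  unfolding delta_decomposable_def
proof (intro subspace_sum[OF subspace_ext_power] subspace_scale[OF subspace_ext_power] wedge_in_ext_power)
  fix i j assume "j \<in> {..<length xs}" "i \<in> {..<j}"
  then show "length (br (xs ! i) (xs ! j) # nths xs (- {i, j})) = k"
    using length_nths_two[of i j xs] assms by simp
qed

context real_lie_algebra
begin

lemma lie_delta_wedge_eq: "lie_delta br (wedge xs) = delta_decomposable br xs"
  by (rule lie_delta_wedge[where br = br, OF bilinear_br br_self])

lemma lie_delta_in_ext_power:
  assumes "p \<in> ext_power (Suc k)"
  shows "lie_delta br p \<in> ext_power k"
  by (rule linear_image_ext_power[OF linear_lie_delta subspace_ext_power _ assms])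
    (simp add: lie_delta_wedge_eq delta_decomposable_in_ext_power)

lemma lie_delta_eq_0:
  assumes "p \<in> ext_power (Suc 0)"
  shows "lie_delta br p = 0"
proof -
  have "lie_delta br p \<in> {0}"
    by (rule linear_image_ext_power[OF linear_lie_delta _ _ assms])
      (simp_all add: lie_delta_wedge_eq delta_decomposable_def subspace_single_0)
  then show ?thesis by simp
qed

text \<open>Evaluated at an alternating form this is the transpose of
  \<open>ce_diff_ce_diff\<close>.\<close>

lemma lie_delta_lie_delta:
  assumes "p \<in> ext_power k"
  shows "lie_delta br (lie_delta br p) = 0"
proof -
  have "lie_delta br (delta_decomposable br xs) = 0" for xs
  proof
    fix \<alpha> :: "'g list \<Rightarrow> real"
    show "lie_delta br (delta_decomposable br xs) \<alpha> = 0 \<alpha>"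
    proof (cases "\<exists>j. alternating_on UNIV j \<alpha>")
      case True
      then obtain j where j: "alternating_on UNIV j \<alpha>" ..
      have "lie_delta br (delta_decomposable br xs) \<alpha> = delta_decomposable br xs (ce_diff br \<alpha>)"
        by (simp add: lie_delta_def delta_decomposable_apply[OF j])
      also have "\<dots> = ce_diff br (ce_diff br \<alpha>) xs"
        by (rule delta_decomposable_apply[OF alternating_on_ce_diff[OF j]])
      also have "\<dots> = 0"
        by (rule ce_diff_ce_diff[OF j])
      finally show ?thesis by simp
    next
      case False
      \<comment> \<open>By normalisation every \<open>wedge\<close> is 0 at a function that is
        alternating in no degree.\<close>
      then have "(\<lambda>ys. delta_decomposable br ys \<alpha>) = (\<lambda>ys. 0)"
        by (simp add: delta_decomposable_def sum_fun_apply wedge_def)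
      then show ?thesis
        by (simp add: lie_delta_def delta_decomposable_apply[OF alternating_on_zero] ce_diff_def)
    qed
  qed
  then have "(lie_delta br \<circ> lie_delta br) p \<in> {0}"
    by (intro linear_image_ext_power[OF linear_compose[OF linear_lie_delta linear_lie_delta] _ _ assms])
      (simp_all add: lie_delta_wedge_eq subspace_single_0)
  then show ?thesis by simp
qed

end

section \<open>Contractions of a closed invariant form of degree \<open>N\<close> along an
  action\<close>

locale preserving_action = manifold X A + real_lie_algebra br
  for X :: "'a topology" and A :: "('a, 'e::real_inner) chart set" and br :: "'g::real_vector \<Rightarrow> 'g \<Rightarrow> 'g" +
  fixes v :: "'g \<Rightarrow> ('a, 'e) vfield" and N :: nat and \<omega> :: "('a, 'e) form"
  assumes form: "\<omega> \<in> forms A N" and closed: "ext_deriv A \<omega> = 0"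
    and action: "lie_algebra_action A br v" and preserved: "lie_deriv A (v x) \<omega> = 0"
begin

definition iota :: "'g list \<Rightarrow> ('a, 'e) form" where
  "iota xs = fold (\<lambda>x. interior_product (v x)) xs \<omega>"

lemma action_field: "v x \<in> vector_fields A"
  and action_linear: "linear v"
  and action_bracket: "v (br x y) = lie_bracket A (v x) (v y)"
  using action by (auto simp: lie_algebra_action_def)

lemma contract_wedge_eq: "contract v \<omega> (wedge xs) = iota xs"
  unfolding iota_def by (rule contract_wedge[OF form action_linear action_field])

lemma iota_Nil: "iota [] = \<omega>"
  by (simp add: iota_def)

lemma iota_snoc: "iota (xs @ [x]) = interior_product (v x) (iota xs)"
  by (simp add: iota_def)

lemma iota_apply: "iota xs m us = \<omega> m (map (\<lambda>x. v x m) xs @ us)"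
  by (simp add: iota_def fold_interior_product)

lemma iota_in_forms: "length xs \<le> N \<Longrightarrow> iota xs \<in> forms A (N - length xs)"
proof (induction xs rule: rev_induct)
  case (snoc x xs)
  then have "iota xs \<in> forms A (Suc (N - length (xs @ [x])))" by (simp add: Suc_diff_Suc)
  then show ?case by (simp add: iota_snoc interior_product_in_forms[OF action_field])
qed (simp add: iota_Nil form)

text \<open>With \<open>m\<close> and \<open>us\<close> fixed, contraction becomes an alternating
  form on the Lie algebra, so the algebraic Cartan calculus applies to it. Some degree suffices for
  that; off the tangent spaces the form is 0.\<close>

lemma alternating_on_iota: "\<exists>k. alternating_on UNIV k (\<lambda>xs. iota xs m us)"
proof (cases "m \<in> points A \<and> set us \<subseteq> tangent_space A m")
  case True
  define c where "c = chart_at A m"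
  have c: "c \<in> charts_at A m" using True by (simp add: c_def chart_atI)
  then have cA: "c \<in> A" "coord c m \<in> coord c ` chart_dom c" "param c (coord c m) = m"
    by (auto simp: charts_at_def)
  \<comment> \<open>A chart is used because \<open>?L\<close> alternates on the whole model space,
    as \<open>alternating_on_append\<close> demands, while \<open>\<omega> m\<close> does so on the
    tangent space.\<close>
  let ?L = "local_form A c \<omega> (coord c m)" and ?es = "map (\<lambda>u. u c) us" and ?f = "\<lambda>x. v x m c"
  have "iota xs m us = ?L (map ?f xs @ ?es)" for xs
  proof -
    have "map (chart_vector A c m) (map ?f xs) = map (\<lambda>x. v x m) xs"
      using map_chart_vector_components[OF c, of "map (\<lambda>x. v x m) xs"]
        vector_field_tangent[OF action_field] True by (auto simp: comp_def)
    then show ?thesis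
      using map_chart_vector_components[OF c, of us] True
      by (simp add: local_form_def iota_apply cA(3) del: map_map)
  qed
  moreover have "alternating_on UNIV (N - length ?es) (\<lambda>xs. ?L (map ?f xs @ ?es))"
    by (rule alternating_on_pullback[OF alternating_on_append[OF alternating_on_local_form[OF form cA(1,2)]]])
      (auto intro!: linearI simp: linear_add[OF action_linear] linear_scale[OF action_linear])
  ultimately show ?thesis by auto
next
  case False
  then have "(\<lambda>xs. iota xs m us) = (\<lambda>xs. 0)"
    by (intro ext) (simp add: iota_apply, rule form_eq_0[OF form], auto)
  then show ?thesis using alternating_on_zero by metis
qed

text \<open>Invariance of \<open>\<omega>\<close> starts the induction; each contraction adds the
  bracket term of \<open>lie_deriv_interior_product\<close>, the last term of
  \<open>ad_form_append\<close>. The list \<open>us\<close> varies because contraction puts a field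
  value in front of it.\<close>

lemma lie_deriv_iota:
  "length xs \<le> N \<Longrightarrow> lie_deriv A (v x) (iota xs) m us = ad_form br x (\<lambda>ys. iota ys m us) xs"
proof (induction xs arbitrary: us rule: rev_induct)
  case Nil
  then show ?case by (simp add: iota_Nil preserved ad_form_def)
next
  case (snoc y xs)
  have "lie_deriv A (v x) (interior_product (v y) (iota xs)) m us =
      lie_deriv A (v x) (iota xs) m (v y m # us) + iota xs m (v (br x y) m # us)"
    using lie_deriv_interior_product[OF action_field[of x] action_field[of y] _ iota_in_forms[of xs]]
      action_field[of "br x y"] snoc.prems by (simp add: action_bracket)
  then show ?case
    using snoc by (simp add: ad_form_append iota_snoc interior_product_def)
qed

text \<open>Both sides obey the same recursion in the last vector, by \<open>cartan_formula\<close>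
  and by \<open>ce_diff_append\<close>; closedness of \<open>\<omega>\<close> is the start.\<close>

lemma ext_deriv_iota:
  "length xs \<le> N \<Longrightarrow> ext_deriv A (iota xs) m us = (- 1) ^ length xs * ce_diff br (\<lambda>ys. iota ys m us) xs"
proof (induction xs arbitrary: us rule: rev_induct)
  case Nil
  then show ?case by (simp add: iota_Nil closed ce_diff_def)
next
  case (snoc x xs)
  obtain k where k: "alternating_on UNIV k (\<lambda>ys. iota ys m us)" using alternating_on_iota ..
  have "ext_deriv A (iota (xs @ [x])) m us = lie_deriv A (v x) (iota xs) m us - ext_deriv A (iota xs) m (v x m # us)"
    using cartan_formula[OF action_field iota_in_forms] snoc.prems by (simp add: iota_snoc)
  also have "\<dots> = ad_form br x (\<lambda>ys. iota ys m us) xs -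
      (- 1) ^ length xs * ce_diff br (\<lambda>ys. iota (ys @ [x]) m us) xs"
    using snoc lie_deriv_iota by (simp add: iota_snoc interior_product_def)
  also have "\<dots> = (- 1) ^ length (xs @ [x]) * ce_diff br (\<lambda>ys. iota ys m us) (xs @ [x])"
    unfolding ce_diff_append[OF k] by (simp add: algebra_simps flip: power_mult_distrib mult.assoc)
  finally show ?case .
qed

lemma contract_in_forms:
  assumes "k \<le> N" "p \<in> ext_power k"
  shows "contract v \<omega> p \<in> forms A (N - k)"
  using assms(1)
  by (intro linear_image_ext_power[OF linear_contract subspace_forms _ assms(2)])
    (auto simp: contract_wedge_eq intro: iota_in_forms)

lemma ext_deriv_contract:
  assumes "k \<le> N" "p \<in> ext_power k"
  shows "ext_deriv A (contract v \<omega> p) = (- 1) ^ k *\<^sub>R contract v \<omega> (lie_delta br p)"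
proof -
  \<comment> \<open>Linearity of \<open>ext_deriv\<close> is available on forms only, so the
    identity is carried from decomposables to all multivectors as a linear relation
    \<open>?T\<close> between pairs.\<close>
  let ?f = "\<lambda>p. (contract v \<omega> p, contract v \<omega> (lie_delta br p))"
  let ?T = "{(\<alpha>, \<beta>). \<alpha> \<in> forms A (N - k) \<and> ext_deriv A \<alpha> = (- 1) ^ k *\<^sub>R \<beta>}"
  have "linear ?f"
    by (intro linearI) (simp_all add: linear_add[OF linear_contract] linear_add[OF linear_lie_delta]
        linear_scale[OF linear_contract] linear_scale[OF linear_lie_delta])
  moreover have "subspace ?T"
  proof (rule subspaceI)
    show "0 \<in> ?T"
      by (simp add: zero_prod_def ext_deriv_zero subspace_0[OF subspace_forms])
  next
    fix x y assume "x \<in> ?T" "y \<in> ?T"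
    then show "x + y \<in> ?T"
      using ext_deriv_linear[where a = 1 and b = 1, of "fst x" "N - k" "fst y"]
      by (auto simp: subspace_add[OF subspace_forms] scaleR_add_right)
  next
    fix c x assume "x \<in> ?T"
    then show "c *\<^sub>R x \<in> ?T"
      using ext_deriv_linear[where a = c and b = 0, of "fst x" "N - k" "fst x"]
      by (auto simp: subspace_scale[OF subspace_forms])
  qed
  moreover have "?f (wedge xs) \<in> ?T" if xs: "length xs = k" for xs
  proof -
    have "ext_deriv A (iota xs) m us = (- 1) ^ k * contract v \<omega> (delta_decomposable br xs) m us" for m us
    proof -
      obtain j where j: "alternating_on UNIV j (\<lambda>ys. iota ys m us)" using alternating_on_iota ..
      show ?thesis
        using ext_deriv_iota[of xs m us] assms(1) xs
        by (simp add: contract_def delta_decomposable_apply[OF j] flip: iota_def)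
    qed
    then show ?thesis
      using iota_in_forms[of xs] assms(1) xs
      by (auto simp: fun_eq_iff contract_wedge_eq lie_delta_wedge_eq)
  qed
  ultimately have "?f p \<in> ?T"
    using assms(2) by (rule linear_image_ext_power)
  then show ?thesis by simp
qed

end

section \<open>Moment maps\<close>

lemma linear_onD:
  "linear_on S f \<Longrightarrow> p \<in> S \<Longrightarrow> q \<in> S \<Longrightarrow> f (a *\<^sub>R p + b *\<^sub>R q) = a *\<^sub>R f p + b *\<^sub>R f q"
  by (simp add: linear_on_def)

lemma linear_on_zero: "linear_on S f \<Longrightarrow> 0 \<in> S \<Longrightarrow> f 0 = 0"
  using linear_onD[of S f 0 0 0 0] by simp

lemma linear_on_subset: "linear_on S f \<Longrightarrow> T \<subseteq> S \<Longrightarrow> linear_on T f"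
  by (auto simp: linear_on_def)

text \<open>Triangular numbers grow by \<open>k + 1\<close>. This sign cancels the one of
  \<open>ext_deriv_contract\<close> in degree \<open>k + 1\<close>.\<close>

lemma zeta_Suc: "zeta (Suc k) = (- 1) ^ Suc k * zeta k"
proof -
  have "Suc k * (Suc k + 1) div 2 = Suc k + k * (k + 1) div 2"
    using div_mult_self4[of 2 "Suc k" "k * (k + 1)"] by (simp add: algebra_simps)
  then show ?thesis unfolding zeta_def by (simp only: power_add mult_minus_right)
qed

lemma zeta_neq_0: "zeta k \<noteq> 0"
  by (simp add: zeta_def)

lemma subspace_lie_kernel: "subspace (lie_kernel br k)"
  unfolding lie_kernel_def
  by (intro subspaceI) (auto simp: subspace_0[OF subspace_ext_power] subspace_add[OF subspace_ext_power]
      subspace_scale[OF subspace_ext_power] linear_0[OF linear_lie_delta]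
      linear_add[OF linear_lie_delta] linear_scale[OF linear_lie_delta])

section \<open>The two implications between moment maps\<close>

context preserving_action
begin

lemma homotopy_imp_weak_moment_map:
  assumes f: "homotopy_moment_map A n \<omega> br v f"
  shows "weak_moment_map A n \<omega> br v f"
    and "p \<in> lie_kernel br (n + 1) \<Longrightarrow> contract v \<omega> p = 0"
proof -
  have lin: "linear_on (ext_power k) (f k)" "f k ` ext_power k \<subseteq> forms A (n - k)" if "k \<in> {1..n}" for k
    using f that by (auto simp: homotopy_moment_map_def)
  \<comment> \<open>In degree 0 this is the convention \<open>f 0 = 0\<close>, otherwise linearity;
    it removes the left side of the equation on the kernel.\<close>
  have f_0: "f k 0 = 0" if "k \<le> n" for k
  proof (cases "k = 0")
    case True
    then show ?thesis using f by (simp add: homotopy_moment_map_def)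
  next
    case False
    then show ?thesis
      using linear_on_zero[OF lin(1) subspace_0[OF subspace_ext_power]] that by simp
  qed
  have eq: "ext_deriv A (f k p) + zeta k *\<^sub>R contract v \<omega> p = 0"
    if k: "k \<in> {1..n+1}" and p: "p \<in> lie_kernel br k" for k p
  proof -
    have "- f (k - 1) (lie_delta br p) = ext_deriv A (f k p) + zeta k *\<^sub>R contract v \<omega> p"
      using f k p unfolding homotopy_moment_map_def lie_kernel_def by blast
    moreover have "f (k - 1) (lie_delta br p) = 0"
      using k p f_0[of "k - 1"] by (simp add: lie_kernel_def le_diff_conv)
    ultimately show ?thesis by simp
  qed
  have sub: "lie_kernel br k \<subseteq> ext_power k" for k by (auto simp: lie_kernel_def)
  show "weak_moment_map A n \<omega> br v f"
    unfolding weak_moment_map_def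
  proof (intro conjI ballI)
    fix k p assume k: "k \<in> {1..n}" and "p \<in> lie_kernel br k"
    then show "ext_deriv A (f k p) = - zeta k *\<^sub>R contract v \<omega> p"
      using eq[of k p] by (simp add: eq_neg_iff_add_eq_0)
  next
    fix k assume k: "k \<in> {1..n}"
    show "linear_on (lie_kernel br k) (f k)"
      by (rule linear_on_subset[OF lin(1)[OF k] sub])
    show "f k ` lie_kernel br k \<subseteq> forms A (n - k)"
      using lin(2)[OF k] sub by blast
  qed
  assume p: "p \<in> lie_kernel br (n + 1)"
  \<comment> \<open>In top degree only the contraction is left, with a nonzero factor.\<close>
  moreover have "f (n + 1) p = 0" using f by (simp add: homotopy_moment_map_def)
  ultimately show "contract v \<omega> p = 0"
    using eq[of "n + 1" p] by (simp add: ext_deriv_zero zeta_neq_0)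
qed

text \<open>In degree \<open>N\<close> the contraction is a 0-form, hence determined by its values
  at the empty list. This turns vanishing of the function \<open>\<phi>\<close> into vanishing of a
  form.\<close>

lemma contract_top_eq_0:
  assumes p: "p \<in> ext_power N" and 0: "\<And>m. m \<in> points A \<Longrightarrow> contract v \<omega> p m [] = 0"
  shows "contract v \<omega> p = 0"
proof (intro ext)
  fix m us
  have form: "contract v \<omega> p \<in> forms A 0" using contract_in_forms[OF _ p] by simp
  show "contract v \<omega> p m us = 0 m us"
  proof (cases "m \<in> points A \<and> us = []")
    case True
    then show ?thesis using 0 by simp
  next
    case False
    then show ?thesis
      using form_eq_0[OF form] alternating_on_support[OF alternating_on_form[OF form], of m us] by auto
  qed
qed

lemma weak_imp_homotopy_moment_map:
  assumes h: "weak_moment_map A n \<omega> br v h" and N: "N = n + 1"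
    and top: "\<And>p. p \<in> lie_kernel br (n + 1) \<Longrightarrow> contract v \<omega> p = 0"
  shows "\<exists>f. homotopy_moment_map A n \<omega> br v f"
proof -
  let ?d = "lie_delta br" and ?c = "contract v \<omega>"
  define B where "B k = ?d ` ext_power (Suc k)" for k
  \<comment> \<open>A linear section of the differential over the boundaries. Its image of
    \<open>B k\<close> is the complement of the kernel in degree \<open>k + 1\<close>.\<close>
  have "\<exists>g. range g \<subseteq> ext_power (Suc k) \<and> linear g \<and> (\<forall>q\<in>B k. ?d (g q) = q)" for k
    unfolding B_def by (rule real_vector.linear_exists_right_inverse_on[OF linear_lie_delta subspace_ext_power])
  then obtain S where S: "\<And>k q. S k q \<in> ext_power (Suc k)" "\<And>k. linear (S k)"
      "\<And>k q. q \<in> B k \<Longrightarrow> ?d (S k q) = q"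
    by (metis rangeI subsetD)
  have "subspace (B k)" for k
    unfolding B_def by (rule linear_subspace_image[OF linear_lie_delta subspace_ext_power])
  \<comment> \<open>A left inverse of the identity on \<open>B k\<close> is a linear projection of
    the whole space onto \<open>B k\<close>.\<close>
  then have "\<exists>g. range g \<subseteq> B k \<and> linear g \<and> (\<forall>q\<in>B k. g q = q)" for k
    using real_vector.linear_exists_left_inverse_on[OF linear_id, of "B k"] by simp
  then obtain P where P: "\<And>k q. P k q \<in> B k" "\<And>k. linear (P k)" "\<And>k q. q \<in> B k \<Longrightarrow> P k q = q"
    by (metis rangeI subsetD)
  \<comment> \<open>\<open>r\<close> is the projection onto the kernel of the differential along the range of \<open>S\<close>, and \<open>P\<close>
     projects that kernel further onto the boundaries.\<close>
  define r where "r k p = p - S (k - 1) (?d p)" for k p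
  \<comment> \<open>\<open>S k\<close> lifts a boundary to degree \<open>k + 1\<close>, hence
    \<open>zeta (Suc k)\<close>. The default 0 provides the conventions in degrees 0 and
    \<open>n + 1\<close>.\<close>
  define f where "f k p = (if k \<in> {1..n}
      then - zeta (Suc k) *\<^sub>R ?c (S k (P k (r k p))) + h k (r k p - P k (r k p)) else 0)" for k p
  have B_kernel: "B k \<subseteq> lie_kernel br k" for k
    by (auto simp: B_def lie_kernel_def lie_delta_in_ext_power lie_delta_lie_delta)
  have d_B: "?d p \<in> B j" if "p \<in> ext_power (Suc j)" for p j
    using that by (simp add: B_def)
  have r_kernel: "r (Suc j) p \<in> lie_kernel br (Suc j)" if "p \<in> ext_power (Suc j)" for p j
    using that S d_B[OF that]
    by (simp add: r_def lie_kernel_def subspace_diff[OF subspace_ext_power] linear_diff[OF linear_lie_delta])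
  have r_linear: "linear (r k)" for k
    unfolding r_def
    by (intro linear_compose_sub linear_id[unfolded id_def] linear_compose[OF linear_lie_delta S(2), unfolded comp_def])
  have Pr_linear: "linear (\<lambda>p. P k (r k p))" for k
    using linear_compose[OF r_linear P(2)] by (simp add: comp_def)
  have cSPr_linear: "linear (\<lambda>p. ?c (S k (P k (r k p))))" for k
    using linear_compose[OF linear_compose[OF Pr_linear S(2)] linear_contract] by (simp add: comp_def)
  have rest: "r k p - P k (r k p) \<in> lie_kernel br k" if "k \<in> {1..n}" "p \<in> ext_power k" for k p
    using r_kernel[of p "k - 1"] that B_kernel P(1) by (intro subspace_diff[OF subspace_lie_kernel]) auto
  have h_lin: "linear_on (lie_kernel br k) (h k)" and h_forms: "h k ` lie_kernel br k \<subseteq> forms A (n - k)"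
    and h_eq: "\<And>p. p \<in> lie_kernel br k \<Longrightarrow> ext_deriv A (h k p) = - zeta k *\<^sub>R ?c p"
    if "k \<in> {1..n}" for k
    using h that by (auto simp: weak_moment_map_def)
  have cS_forms: "?c (S k q) \<in> forms A (n - k)" if "k \<in> {1..n}" for k q
    using contract_in_forms[OF _ S(1), of k q] that N by simp
  have f_forms: "f k p \<in> forms A (n - k)" if "k \<in> {1..n}" "p \<in> ext_power k" for k p
    using cS_forms[OF that(1)] h_forms[OF that(1)] rest[OF that] that
    by (auto simp: f_def intro!: subspace_diff[OF subspace_forms] subspace_add[OF subspace_forms] subspace_scale[OF subspace_forms])
  have f_lin: "linear_on (ext_power k) (f k)" if k: "k \<in> {1..n}" for k
    unfolding linear_on_def
  proof (intro ballI allI)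
    fix p q :: "'g multivector" and a b assume pq: "p \<in> ext_power k" "q \<in> ext_power k"
    let ?l = "a *\<^sub>R p + b *\<^sub>R q" and ?e = "\<lambda>p. r k p - P k (r k p)"
    have "?e ?l = a *\<^sub>R ?e p + b *\<^sub>R ?e q"
      by (simp add: linear_add[OF r_linear] linear_scale[OF r_linear] linear_add[OF P(2)] linear_scale[OF P(2)]
          scaleR_diff_right)
    then have "h k (?e ?l) = a *\<^sub>R h k (?e p) + b *\<^sub>R h k (?e q)"
      using linear_onD[OF h_lin[OF k] rest[OF k pq(1)] rest[OF k pq(2)]] by simp
    moreover have "?c (S k (P k (r k ?l))) = a *\<^sub>R ?c (S k (P k (r k p))) + b *\<^sub>R ?c (S k (P k (r k q)))"
      by (simp only: linear_add[OF cSPr_linear] linear_scale[OF cSPr_linear])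
    ultimately show "f k ?l = a *\<^sub>R f k p + b *\<^sub>R f k q"
      using k by (simp add: f_def scaleR_add_right scaleR_diff_right mult.commute)
  qed
  \<comment> \<open>The boundary part of \<open>r k p\<close> is treated by
    \<open>ext_deriv_contract\<close>, the rest by the weak moment map; both give the factor
    \<open>- zeta k\<close>.\<close>
  have d_f: "ext_deriv A (f k p) = - zeta k *\<^sub>R ?c (r k p)" if k: "k \<in> {1..n}" and p: "p \<in> ext_power k" for k p
  proof -
    let ?q = "P k (r k p)"
    have "ext_deriv A (f k p) =
        - zeta (Suc k) *\<^sub>R ext_deriv A (?c (S k ?q)) + ext_deriv A (h k (r k p - ?q))"
      using ext_deriv_linear[OF cS_forms[OF k, of ?q] subsetD[OF h_forms[OF k] imageI[OF rest[OF k p]]],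
          where a = "- zeta (Suc k)" and b = 1] k
      by (simp add: f_def)
    also have "ext_deriv A (?c (S k ?q)) = (- 1) ^ Suc k *\<^sub>R ?c ?q"
      using ext_deriv_contract[OF _ S(1), of k ?q] k N S(3)[OF P(1)] by simp
    also have "- zeta (Suc k) *\<^sub>R (- 1) ^ Suc k *\<^sub>R ?c ?q = - zeta k *\<^sub>R ?c ?q"
      by (simp add: zeta_Suc flip: power_mult_distrib)
    also have "ext_deriv A (h k (r k p - ?q)) = - zeta k *\<^sub>R ?c (r k p - ?q)"
      by (rule h_eq[OF k rest[OF k p]])
    finally have "ext_deriv A (f k p) = - zeta k *\<^sub>R (?c ?q + ?c (r k p - ?q))"
      unfolding scaleR_add_right .
    also have "?c ?q + ?c (r k p - ?q) = ?c (r k p)"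
      by (simp add: linear_diff[OF linear_contract])
    finally show ?thesis .
  qed
  \<comment> \<open>A boundary is fixed by \<open>r j\<close> and \<open>P j\<close>, so the weak
    moment map is evaluated at 0 and only the lifted contraction survives. For \<open>j = 0\<close>
    both sides are 0.\<close>
  have f_d: "- f j (?d p) = zeta (Suc j) *\<^sub>R ?c (S j (?d p))" if "j \<le> n" and p: "p \<in> ext_power (Suc j)" for j p
  proof (cases "j = 0")
    case True
    then show ?thesis
      using p by (simp add: f_def lie_delta_eq_0 linear_0[OF S(2)] linear_0[OF linear_contract])
  next
    case False
    then have j: "j \<in> {1..n}" using that by simp
    have "r j (?d p) = ?d p"
      using p by (simp add: r_def lie_delta_lie_delta linear_0[OF S(2)])
    then show ?thesis
      using j P(3)[OF d_B[OF p]] linear_on_zero[OF h_lin[OF j] subspace_0[OF subspace_lie_kernel]]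
      by (simp add: f_def)
  qed
  have "- f (k - 1) (?d p) = ext_deriv A (f k p) + zeta k *\<^sub>R ?c p"
    if "k \<in> {1..n+1}" "p \<in> ext_power k" for k p
  proof -
    have "k = Suc (k - 1)" "k - 1 \<le> n" using that(1) by auto
    then obtain j where j: "k = Suc j" "j \<le> n" by blast
    \<comment> \<open>This splits \<open>p\<close> into its kernel part and the lift of its
      boundary; the equation then is the sum of \<open>d_f\<close> and \<open>f_d\<close>.\<close>
    have c: "?c p = ?c (r k p) + ?c (S j (?d p))"
      using linear_add[OF linear_contract, of v \<omega> "r k p" "S j (?d p)"] by (simp add: r_def j)
    have "ext_deriv A (f k p) = - zeta k *\<^sub>R ?c (r k p)"
    proof (cases "k = n + 1")
      \<comment> \<open>Here \<open>f k\<close> is 0, and the contraction with the kernel element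
        \<open>r k p\<close> vanishes by \<open>top\<close>.\<close>
      case True
      then show ?thesis
        using top[of "r k p"] r_kernel[of p n] that(2) by (simp add: f_def ext_deriv_zero)
    next
      case False
      then show ?thesis using d_f that by simp
    qed
    then show ?thesis
      using f_d[OF j(2)] that(2) j(1) by (simp add: c scaleR_add_right)
  qed
  then have "homotopy_moment_map A n \<omega> br v f"
    unfolding homotopy_moment_map_def using f_lin f_forms by (auto simp: f_def fun_eq_iff)
  then show ?thesis by (rule exI[where x = f])
qed

end

theorem theorem2p8:
  fixes X :: "'a topology"
    and A :: "('a, 'e::real_inner) chart set"
    and n :: nat
    and \<omega> :: "('a, 'e) form"
    and br :: "'g::real_vector \<Rightarrow> 'g \<Rightarrow> 'g"
    and v :: "'g \<Rightarrow> ('a, 'e) vfield"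
  assumes "n_plectic X A n \<omega>"
    and "fin_dim_lie_algebra br"
    and "lie_algebra_action A br v"
    and "\<And>x. lie_deriv A (v x) \<omega> = 0"
  shows "(\<exists>f. homotopy_moment_map A n \<omega> br v f) \<longleftrightarrow>
         (\<exists>f. weak_moment_map A n \<omega> br v f) \<and>
         (\<forall>p\<in>lie_kernel br (n + 1). \<forall>m\<in>points A. contract v \<omega> p m [] = 0)"
proof -
  interpret preserving_action X A br v "n + 1" \<omega>
    by unfold_locales (use assms in \<open>auto simp: n_plectic_def fin_dim_lie_algebra_def\<close>)
  show ?thesis
  proof (intro iffI conjI ballI; (elim exE conjE)?)
    fix f assume f: "homotopy_moment_map A n \<omega> br v f"
    then show "\<exists>f. weak_moment_map A n \<omega> br v f"
      using homotopy_imp_weak_moment_map(1) by blast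
    fix p m assume "p \<in> lie_kernel br (n + 1)"
    then show "contract v \<omega> p m [] = 0"
      using homotopy_imp_weak_moment_map(2)[OF f] by simp
  next
    fix h assume "weak_moment_map A n \<omega> br v h"
      and "\<forall>p\<in>lie_kernel br (n + 1). \<forall>m\<in>points A. contract v \<omega> p m [] = 0"
    then show "\<exists>f. homotopy_moment_map A n \<omega> br v f"
      by (intro weak_imp_homotopy_moment_map contract_top_eq_0) (auto simp: lie_kernel_def)
  qed
qed

end
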